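(* Let $\mathcal{M}$ be a PCA model and let $\mathcal{S}$ be its synthetic graph. The following statements are equivalent: (1) $\mathcal{M}$ is equivalent to a UCA model. (2) For every two circuits $\mathcal{W},\mathcal{W}'$ of $\mathcal{S}$ such that $\operatorname{Ext}(\mathcal{W})$ and $\operatorname{Ext}(\mathcal{W}')$ have different signs (where the possible signs are negative, zero, positive), $\mathcal{W}$ and $\mathcal{W}'$ have a common vertex. (3) Some greedy hollow cycle and some greedy nose cycle of $\mathcal{S}$ share a vertex.
   Context: A PCA (proper circular-arc) model is a pair $\mathcal{M}=(C,\mathcal{A})$ where $C$ is a circle with a distinguished point $0$ (every point $p$ of $C$ is identified with the clockwise length from $0$ to $p$) and $\mathcal{A}$ is a finite family of open arcs of $C$, none contained in another, such that no two arcs of $\mathcal{A}$ together cover $C$. For points $s,t$ of $C$, $(s,t)$ denotes the open arc going clockwise from $s$ to $t$; an arc $A=(s,t)$ has extremes $s(A)=s$ and $t(A)=t$. The extremes of $\mathcal{M}$ are the extremes of its arcs; an ordered pair $e_1e_2$ of extremes is consecutive if no extreme of $\mathcal{M}$ lies in $(e_1,e_2)$. An arc $A$ (of $C$) is external if $A\cup\{t(A)\}$ contains $0$, and internal otherwise. The arcs of $\mathcal{A}$ are ordered $A_0<\dots<A_{n-1}$ according to the order in which their starting points $s(\cdot)$ appear in a clockwise traversal of $C$ from $0$. Two PCA models $(C,\mathcal{A})$, $(C',\mathcal{A}')$ are equivalent if there is a bijection $f:\mathcal{A}\to\mathcal{A}'$ such that for all arcs $A,B$ and $e,e'\in\{s,t\}$,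 $e(f(A))<e'(f(B))$ iff $e(A)<e'(B)$ (extremes compared as positions in the clockwise traversal from the respective points $0$). A UCA model is a PCA model all of whose arcs have the same length. The synthetic graph $\mathcal{S}$ of $\mathcal{M}$ is the directed multigraph with one vertex per arc of $\mathcal{A}$ (identified with the arc) and whose edges are: steps $A_i\to A_{i+1}$ for $i<n-1$ and $A_{n-1}\to A_0$; noses $A_i\to A_j$ whenever $t(A_i)s(A_j)$ are consecutive extremes; hollows $A_i\to A_j$ whenever $s(A_i)t(A_j)$ are consecutive extremes (edges of different kinds between the same pair of vertices are kept as distinct edges). A step or nose $A_i\to A_j$ is external iff the arc $(s(A_i),s(A_j))$ is external; a hollow $A_i\to A_j$ is external iff the arc $(s(A_j),s(A_i))$ is external; other edges are internal. A walk is a sequence of edges $v_0v_1,v_1v_2,\dots,v_{k-1}v_k$; it is a circuit if $v_k=v_0$, and a cycle if moreover $v_0,\dots,v_{k-1}$ are pairwise distinct. For a walk $\mathcal{W}$ (counting edges with multiplicity), $\operatorname{Ext}(\mathcal{W})$ is the number of external hollows minus the number of external noses minus the number of external steps of $\mathcal{W}$. A nose walk is a walk with no hollows, a hollow walk is a walk with no noses. A nose (resp. hollow) walk $B_0,\dots,B_k$ is greedy if for each $i$ the edge $B_i\to B_{i+1}$ is a nose (resp. hollow) or no nose (resp. hollow) leaves $B_i$ in $\mathcal{S}$. A greedy nose (hollow) cycle is a cycle that is a greedy nose (hollow) walk.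
   Formalization: The family of arcs is assumed nonempty and all extremes are assumed distinct (no arc ends where an arc starts), since otherwise the equivalence fails; a hollow that is a loop, for which the arc (s,s) is undefined, is taken as internal. *)

theory Defs
  imports Complex_Main
begin

type_synonym arc = "real \<times> real"

abbreviation start :: "arc \<Rightarrow> real" where "start \<equiv> fst"
abbreviation stop :: "arc \<Rightarrow> real" where "stop \<equiv> snd"

text \<open>
  A circle of length \<open>c\<close> is the interval \<open>{0..<c}\<close>, each point being identified with the
  clockwise distance from the distinguished point \<open>0\<close>.  An arc is represented by its pair of
  extremes.
\<close>

record ca_model =
  circ :: real
  arcs :: "arc set"

text \<open>
  The open arc going clockwise from \<open>s\<close> to \<open>t\<close>.  For \<open>s = t\<close> it is a full turn, i.e. the circle
  without \<open>s\<close>.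
\<close>

definition cw_arc :: "ca_model \<Rightarrow> real \<Rightarrow> real \<Rightarrow> real set" where
  "cw_arc M s t = (if s < t then {s<..<t} else {s<..<circ M} \<union> {0..<t})"

definition arc_points :: "ca_model \<Rightarrow> arc \<Rightarrow> real set" where
  "arc_points M A = cw_arc M (start A) (stop A)"

definition arc_length :: "ca_model \<Rightarrow> arc \<Rightarrow> real" where
  "arc_length M A =
     (if start A < stop A then stop A - start A else circ M - start A + stop A)"

definition extremes :: "ca_model \<Rightarrow> real set" where
  "extremes M = start ` arcs M \<union> stop ` arcs M"

text \<open>
  As usual for circular-arc models, the \<open>2n\<close> extremes are pairwise distinct points.  Absence of
  containment already separates the starting points from each other, and likewise the end points,
  so the last conjunct only excludes arcs that touch, i.e. \<open>stop A = start B\<close> (and, for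
  \<open>A = B\<close>, degenerate arcs).
\<close>

definition PCA_model :: "ca_model \<Rightarrow> bool" where
  "PCA_model M \<longleftrightarrow>
     0 < circ M \<and>
     finite (arcs M) \<and>
     extremes M \<subseteq> {0..<circ M} \<and>
     (\<forall>A\<in>arcs M. \<forall>B\<in>arcs M. A \<noteq> B \<longrightarrow> \<not> arc_points M A \<subseteq> arc_points M B) \<and>
     (\<forall>A\<in>arcs M. \<forall>B\<in>arcs M. arc_points M A \<union> arc_points M B \<noteq> {0..<circ M}) \<and>
     (\<forall>A\<in>arcs M. \<forall>B\<in>arcs M. stop A \<noteq> start B)"

definition UCA_model :: "ca_model \<Rightarrow> bool" where
  "UCA_model M \<longleftrightarrow>
     PCA_model M \<and> (\<forall>A\<in>arcs M. \<forall>B\<in>arcs M. arc_length M A = arc_length M B)"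

definition equivalent_models :: "ca_model \<Rightarrow> ca_model \<Rightarrow> bool" where
  "equivalent_models M M' \<longleftrightarrow>
     (\<exists>f. bij_betw f (arcs M) (arcs M') \<and>
          (\<forall>A\<in>arcs M. \<forall>B\<in>arcs M. \<forall>e\<in>{start, stop}. \<forall>e'\<in>{start, stop}.
             e (f A) < e' (f B) \<longleftrightarrow> e A < e' B))"

definition consecutive :: "ca_model \<Rightarrow> real \<Rightarrow> real \<Rightarrow> bool" where
  "consecutive M e e' \<longleftrightarrow> cw_arc M e e' \<inter> extremes M = {}"

definition external_arc :: "ca_model \<Rightarrow> real \<Rightarrow> real \<Rightarrow> bool" where
  "external_arc M s t \<longleftrightarrow> 0 \<in> cw_arc M s t \<union> {t}"

text \<open>The arcs \<open>A\<^sub>0 < \<dots> < A\<^sub>n\<^sub>-\<^sub>1\<close> in the clockwise order of their starting points.\<close>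

definition arc_list :: "ca_model \<Rightarrow> arc list" where
  "arc_list M = sorted_key_list_of_set start (arcs M)"

datatype edge_kind = Step | Nose | Hollow

datatype edge = Edge (tail: arc) (kind: edge_kind) (head: arc)

definition synthetic_edges :: "ca_model \<Rightarrow> edge set" where
  "synthetic_edges M =
     {Edge (arc_list M ! i) Step (arc_list M ! (Suc i mod length (arc_list M))) |i.
        i < length (arc_list M)} \<union>
     {Edge A Nose B |A B. A \<in> arcs M \<and> B \<in> arcs M \<and> consecutive M (stop A) (start B)} \<union>
     {Edge A Hollow B |A B. A \<in> arcs M \<and> B \<in> arcs M \<and> consecutive M (start A) (stop B)}"

text \<open>
  A hollow from \<open>A\<close> to \<open>B\<close> goes counterclockwise from \<open>start A\<close> to \<open>start B\<close> inside the arc \<open>B\<close>.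
  Hence for a hollow loop the arc from \<open>start B\<close> to \<open>start A\<close> is empty and the loop is internal,
  whereas a step or nose that is a loop (possible only if there is a single arc) is a full turn.
\<close>

definition external_edge :: "ca_model \<Rightarrow> edge \<Rightarrow> bool" where
  "external_edge M e \<longleftrightarrow>
     (case kind e of
        Hollow \<Rightarrow> tail e \<noteq> head e \<and> external_arc M (start (head e)) (start (tail e))
      | _ \<Rightarrow> external_arc M (start (tail e)) (start (head e)))"

definition walk :: "ca_model \<Rightarrow> edge list \<Rightarrow> bool" where
  "walk M W \<longleftrightarrow>
     W \<noteq> [] \<and> set W \<subseteq> synthetic_edges M \<and>
     (\<forall>i. Suc i < length W \<longrightarrow> head (W ! i) = tail (W ! Suc i))"

definition circuit :: "ca_model \<Rightarrow> edge list \<Rightarrow> bool" where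
  "circuit M W \<longleftrightarrow> walk M W \<and> head (last W) = tail (hd W)"

definition cycle :: "ca_model \<Rightarrow> edge list \<Rightarrow> bool" where
  "cycle M W \<longleftrightarrow> circuit M W \<and> distinct (map tail W)"

definition walk_vertices :: "edge list \<Rightarrow> arc set" where
  "walk_vertices W = tail ` set W \<union> head ` set W"

definition count_external :: "ca_model \<Rightarrow> edge_kind \<Rightarrow> edge list \<Rightarrow> nat" where
  "count_external M k W = length (filter (\<lambda>e. kind e = k \<and> external_edge M e) W)"

definition Ext :: "ca_model \<Rightarrow> edge list \<Rightarrow> int" where
  "Ext M W = int (count_external M Hollow W) - int (count_external M Nose W)
               - int (count_external M Step W)"

definition nose_walk :: "ca_model \<Rightarrow> edge list \<Rightarrow> bool" where
  "nose_walk M W \<longleftrightarrow> walk M W \<and> (\<forall>e\<in>set W. kind e \<noteq> Hollow)"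

definition hollow_walk :: "ca_model \<Rightarrow> edge list \<Rightarrow> bool" where
  "hollow_walk M W \<longleftrightarrow> walk M W \<and> (\<forall>e\<in>set W. kind e \<noteq> Nose)"

definition greedy_nose_walk :: "ca_model \<Rightarrow> edge list \<Rightarrow> bool" where
  "greedy_nose_walk M W \<longleftrightarrow> nose_walk M W \<and>
     (\<forall>e\<in>set W. kind e = Nose \<or> (\<nexists>B. Edge (tail e) Nose B \<in> synthetic_edges M))"

definition greedy_hollow_walk :: "ca_model \<Rightarrow> edge list \<Rightarrow> bool" where
  "greedy_hollow_walk M W \<longleftrightarrow> hollow_walk M W \<and>
     (\<forall>e\<in>set W. kind e = Hollow \<or> (\<nexists>B. Edge (tail e) Hollow B \<in> synthetic_edges M))"

definition greedy_nose_cycle :: "ca_model \<Rightarrow> edge list \<Rightarrow> bool" where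
  "greedy_nose_cycle M W \<longleftrightarrow> cycle M W \<and> greedy_nose_walk M W"

definition greedy_hollow_cycle :: "ca_model \<Rightarrow> edge list \<Rightarrow> bool" where
  "greedy_hollow_cycle M W \<longleftrightarrow> cycle M W \<and> greedy_hollow_walk M W"

end

theory Submission
  imports Defs
begin

text \<open>
  Unroll the circle and number the lifted starting points by the integers, so that arc \<open>x + n\<close> is
  arc \<open>x\<close> after a full turn.  Let \<open>nu x\<close> be the first arc starting after the end of \<open>x\<close>, and \<open>eta x\<close>
  the first arc ending after the start of \<open>x\<close>.  These monotone maps satisfy
  \<open>nu k \<le> m \<longleftrightarrow> k < eta m\<close>, greedy nose (hollow) walks follow the orbits of \<open>nu\<close> (of \<open>eta\<close>), and
  the winding number of a circuit is the negative of its \<open>Ext\<close>.  A unit model is a map \<open>\<psi>\<close>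
  of the integers to the line that makes \<open>nu\<close> and \<open>eta\<close> compatible with the translation by the
  common length \<open>l\<close>.

  If a unit model exists, place the vertex \<open>x\<close> on every level \<open>u\<close> of the plane at position
  \<open>\<psi> x - u * l\<close>; noses go up and hollows go down one level, and all edges go to the right without
  jumping over a vertex of the level they leave.  Circuits lift to periodic paths, and paths of
  different slopes must meet in a vertex; circuits with different signs of \<open>Ext\<close> have different
  slopes.

  A greedy hollow cycle has \<open>Ext \<ge> 0\<close> and a greedy nose cycle has \<open>Ext < 0\<close>, so the condition on
  circuits makes them meet.  Finally, if \<open>x\<close> lies on both, then \<open>x < eta^i (nu^i x)\<close> shows that the
  rotation number of \<open>nu\<close> exceeds that of the inverse direction of \<open>eta\<close>.  For \<open>l\<close> in between, the
  infimum of \<open>nu^q x - q * l\<close> and \<open>eta^q x + q * l\<close> over all \<open>q\<close> satisfies all constraints weakly; the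
  tight constraints form an acyclic relation, so a small perturbation makes them strict.
\<close>

section \<open>Potentials for monotone maps of the integers\<close>

lemma int_strict_monoI:
  fixes f :: "int \<Rightarrow> 'a::order"
  assumes "\<And>x. f x < f (x + 1)"
  shows "strict_mono f"
proof (rule strict_monoI)
  fix x y :: int
  assume "x < y"
  then have "x + 1 \<le> y" by simp
  then show "f x < f y"
    by (induction y rule: int_ge_induct) (use assms less_trans in blast)+
qed

lemma shift_multiple:
  fixes f :: "int \<Rightarrow> 'a::comm_ring_1"
  assumes "\<And>m. f (m + n) = f m + c"
  shows "f (m + n * t) = f m + c * of_int t"
proof (induction t rule: int_induct[where k = 0])
  case (step1 i)
  have "f (m + n * (i + 1)) = f ((m + n * i) + n)" by (simp add: algebra_simps)
  also have "\<dots> = f (m + n * i) + c" by (rule assms)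
  finally show ?case using step1 by (simp add: algebra_simps)
next
  case (step2 i)
  have "f (m + n * i) = f ((m + n * (i - 1)) + n)" by (simp add: algebra_simps)
  also have "\<dots> = f (m + n * (i - 1)) + c" by (rule assms)
  finally show ?case using step2 by (simp add: algebra_simps)
qed simp

lemma funpow_shift:
  fixes f :: "int \<Rightarrow> int"
  assumes "\<And>m. f (m + n) = f m + n"
  shows "(f ^^ q) (m + n * t) = (f ^^ q) m + n * t"
  using shift_multiple[of f n n] assms by (induction q) auto

text \<open>The orbit of \<open>z\<close> repeats every \<open>k\<close> iterations up to a
  translation, so it advances at the average rate \<open>n * t / k\<close>. Any \<open>x\<close>
  lies less than \<open>n\<close> above a translate of \<open>z\<close>, and monotonicity carries
  the rate over to the orbit of \<open>x\<close> with a bounded error.\<close>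

lemma funpow_lower_bound:
  fixes f :: "int \<Rightarrow> int"
  assumes "mono f" and shift: "\<And>m. f (m + n) = f m + n" and "0 < n"
    and per: "(f ^^ k) z = z + n * t" and "0 < k"
  obtains K where
    "\<And>x q. real_of_int x + real q * (real_of_int (n * t) / real k) - K \<le> real_of_int ((f ^^ q) x)"
proof -
  have fk: "((f ^^ k) ^^ a) z = z + n * (t * int a)" for a
  proof (induction a)
    case (Suc a)
    then show ?case using per funpow_shift[of f n k z "t * int a", OF shift]
      by (simp add: algebra_simps)
  qed simp
  \<comment> \<open>The largest deviation from \<open>z\<close> within one period of its
    orbit.\<close>
  define K1 where "K1 = Max ((\<lambda>b. \<bar>(f ^^ b) z - z\<bar>) ` {..<k})"
  have K1: "z - K1 \<le> (f ^^ b) z" if "b < k" for b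
  proof -
    have "\<bar>(f ^^ b) z - z\<bar> \<le> K1" unfolding K1_def using that by (intro Max_ge) auto
    then show ?thesis by linarith
  qed
  define r where "r = real_of_int (n * t) / real k"
  \<comment> \<open>The summands pay for an incomplete period, for its share of the average advance,
    and for the distance from \<open>x\<close> down to the translate of \<open>z\<close>.\<close>
  define K where "K = real_of_int K1 + \<bar>real_of_int (n * t)\<bar> + real_of_int n"
  have "real_of_int x + real q * r - K \<le> real_of_int ((f ^^ q) x)" for x q
  proof -
    define u v where "u = (x - z) div n" and "v = (x - z) mod n"
    have x: "x = z + n * u + v" "0 \<le> v" "v < n"
      using \<open>0 < n\<close> by (auto simp: u_def v_def)
    define a b where "a = q div k" and "b = q mod k"
    have q: "q = b + k * a" "b < k" using \<open>0 < k\<close> by (auto simp: a_def b_def)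
    have "(f ^^ q) z = (f ^^ b) (z + n * (t * int a))"
      unfolding q funpow_add funpow_mult[symmetric] using fk[of a] by simp
    then have fq: "(f ^^ q) z = (f ^^ b) z + n * t * int a"
      using funpow_shift[of f n b z "t * int a", OF shift] by (simp add: mult.assoc)
    have "z + n * u \<le> x" using x by simp
    then have "(f ^^ q) (z + n * u) \<le> (f ^^ q) x"
      using funpow_mono[OF \<open>mono f\<close>] by blast
    then have "z - K1 + n * t * int a + n * u \<le> (f ^^ q) x"
      using fq funpow_shift[of f n q z u, OF shift] K1[OF q(2)] by linarith
    then have 1: "real_of_int (z - K1 + n * t * int a + n * u) \<le> real_of_int ((f ^^ q) x)"
      by linarith
    have "real q * r = real b * r + real_of_int (n * t) * real a"
      using \<open>0 < k\<close> by (simp add: q r_def field_simps)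
    moreover have "real b * r \<le> \<bar>real_of_int (n * t)\<bar>"
    proof -
      have "real b * r \<le> real b * \<bar>r\<bar>" by (intro mult_left_mono) auto
      also have "\<dots> \<le> real k * \<bar>r\<bar>" using q(2) by (intro mult_right_mono) auto
      also have "\<dots> = \<bar>real_of_int (n * t)\<bar>" using \<open>0 < k\<close> by (simp add: r_def abs_divide)
      finally show ?thesis .
    qed
    moreover have "real_of_int x \<le> real_of_int z + real_of_int n * real_of_int u + real_of_int n"
      using x by (metis add_left_mono less_imp_le of_int_add of_int_le_iff of_int_mult)
    ultimately show ?thesis using 1 unfolding K_def by (simp add: algebra_simps)
  qed
  then show ?thesis using that r_def by blast
qed

section \<open>From weak to strict potentials\<close>

text \<open>Tight edges become strict by adding a small multiple of a rank that grows along them.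
  The other edges are finitely many, so their slacks have a positive minimum, which a small enough
  perturbation does not use up.\<close>

lemma strict_potential_of_acyclic_tight:
  fixes \<phi> :: "'v \<Rightarrow> real" and E :: "('v \<times> real \<times> 'v) set"
  assumes fin: "finite E" and weak: "\<And>a w b. (a, w, b) \<in> E \<Longrightarrow> \<phi> a + w \<le> \<phi> b"
    and acyc: "acyclic {(a, b). (a, \<phi> b - \<phi> a, b) \<in> E}"
  obtains \<psi> :: "'v \<Rightarrow> real" where "\<And>a w b. (a, w, b) \<in> E \<Longrightarrow> \<psi> a + w < \<psi> b"
proof -
  define R where "R = {(a, b). (a, \<phi> b - \<phi> a, b) \<in> E}"
  have "R \<subseteq> (\<lambda>(a, w, b). (a, b)) ` E" by (force simp: R_def)
  then have "finite R" using fin finite_surj by blast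
  then have finR: "finite (R\<^sup>+)" by simp
  \<comment> \<open>The number of predecessors in the transitive closure. Along a tight edge it
    grows, because by acyclicity the tail is a predecessor of the head but not of itself.\<close>
  define rank where "rank b = card {a. (a, b) \<in> R\<^sup>+}" for b
  have finp: "finite {a. (a, b) \<in> R\<^sup>+}" for b
    by (rule finite_surj[OF finR, of _ fst]) force
  have rank: "rank a < rank b" if "(a, b) \<in> R" for a b
    unfolding rank_def
  proof (rule psubset_card_mono[OF finp])
    have "a \<notin> {c. (c, a) \<in> R\<^sup>+}" using acyc by (auto simp: R_def acyclic_def)
    moreover have "a \<in> {c. (c, b) \<in> R\<^sup>+}" using that by blast
    moreover have "{c. (c, a) \<in> R\<^sup>+} \<subseteq> {c. (c, b) \<in> R\<^sup>+}"
      using that by (auto intro: trancl_into_trancl)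
    ultimately show "{c. (c, a) \<in> R\<^sup>+} \<subset> {c. (c, b) \<in> R\<^sup>+}" by blast
  qed
  define N where "N = card (R\<^sup>+)"
  have rank_le: "rank b \<le> N" for b
  proof -
    have "card ((\<lambda>a. (a, b)) ` {a. (a, b) \<in> R\<^sup>+}) \<le> N"
      unfolding N_def using finR by (intro card_mono) auto
    then show ?thesis unfolding rank_def by (subst (asm) card_image) (auto simp: inj_on_def)
  qed
  define S where "S = {d. 0 < d \<and> d \<in> (\<lambda>(a, w, b). \<phi> b - \<phi> a - w) ` E}"
  have "finite S" unfolding S_def using fin by simp
  \<comment> \<open>The smallest slack; the element \<open>1\<close> provides a minimum when every
    edge is tight.\<close>
  define \<delta> where "\<delta> = Min (insert 1 S)"
  have \<delta>: "0 < \<delta>" "\<And>d. d \<in> S \<Longrightarrow> \<delta> \<le> d"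
    unfolding \<delta>_def using \<open>finite S\<close> by (auto simp: S_def)
  \<comment> \<open>Ranks are at most \<open>N\<close>, so the perturbation stays below
    \<open>\<delta>\<close>; the \<open>+ 1\<close> covers \<open>N = 0\<close>.\<close>
  define \<epsilon> where "\<epsilon> = \<delta> / (real N + 1)"
  have \<epsilon>: "0 < \<epsilon>" "\<epsilon> * real N < \<delta>" using \<delta>(1) by (auto simp: \<epsilon>_def field_simps)
  have "\<phi> a + \<epsilon> * real (rank a) + w < \<phi> b + \<epsilon> * real (rank b)" if E: "(a, w, b) \<in> E" for a w b
  proof (cases "\<phi> b = \<phi> a + w")
    case True
    then have "(a, b) \<in> R" using E by (auto simp: R_def)
    then have "\<epsilon> * real (rank a) < \<epsilon> * real (rank b)" using rank \<epsilon>(1) by simp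
    then show ?thesis using True by simp
  next
    case False
    then have "\<phi> b - \<phi> a - w \<in> S" using weak[OF E] E by (force simp: S_def)
    then have "\<delta> \<le> \<phi> b - \<phi> a - w" by (rule \<delta>)
    moreover have "\<epsilon> * real (rank a) \<le> \<epsilon> * real N" "0 \<le> \<epsilon> * real (rank b)"
      using rank_le[of a] \<epsilon>(1) by (simp_all add: mult_left_mono)
    ultimately show ?thesis using \<epsilon>(2) by linarith
  qed
  then show ?thesis by (rule that)
qed

section \<open>Adjoint pairs of shift-periodic maps\<close>

text \<open>\<open>adj\<close> is a Galois connection: \<open>nu\<close> is the lower adjoint of the
  map sending \<open>m\<close> to \<open>eta m - 1\<close>. All laws of \<open>eta\<close> follow
  from those of \<open>nu\<close> through it.\<close>

locale nose_hollow =
  fixes n :: int and nu eta :: "int \<Rightarrow> int"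
  assumes n_pos: "0 < n"
    and adj: "\<And>k m. nu k \<le> m \<longleftrightarrow> k < eta m"
    and nu_shift: "\<And>m. nu (m + n) = nu m + n"
    and nu_gt: "\<And>m. m < nu m"
    and nu_le: "\<And>m. nu m \<le> m + n"
begin

lemma eta_shift: "eta (m + n) = eta m + n"
proof -
  have "k < eta (m + n) \<longleftrightarrow> k < eta m + n" for k
    using adj[of k "m + n"] adj[of "k - n" m] nu_shift[of "k - n"] by simp linarith
  from this[of "eta m + n"] this[of "eta (m + n)"] show ?thesis by linarith
qed

lemma eta_le: "eta m \<le> m"
  using adj[of m m] nu_gt[of m] by linarith

lemma eta_gt: "m - n < eta m"
  using adj[of "m - n" m] nu_le[of "m - n"] by simp

lemma eta_nu: "m < eta (nu m)"
  using adj[of m "nu m"] by simp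

lemma nu_eta: "m < nu (eta m)"
  using adj[of "eta m" m] by linarith

lemma nu_mono: "mono nu"
proof (rule monoI)
  fix x y :: int assume "x \<le> y"
  then show "nu x \<le> nu y" using adj[of x "nu y"] eta_nu[of y] by linarith
qed

lemma eta_mono: "mono eta"
proof (rule monoI)
  fix x y :: int assume "x \<le> y"
  then show "eta x \<le> eta y" using adj[of "eta y" x] nu_eta[of y] by linarith
qed

text \<open>The innermost pair \<open>eta (nu _)\<close> does not move back, by
  \<open>eta_nu\<close>, and can be cancelled under the monotone outer iterates. Strictness comes
  from the last remaining pair, hence \<open>0 < q\<close>.\<close>

lemma eta_pow_nu_pow: "0 < q \<Longrightarrow> x < (eta ^^ q) ((nu ^^ q) x)"
proof (induction q)
  case (Suc q)
  have "(eta ^^ q) ((nu ^^ q) x) \<le> (eta ^^ q) (eta (nu ((nu ^^ q) x)))"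
    using eta_nu[of "(nu ^^ q) x"] by (intro funpow_mono[OF eta_mono]) simp
  moreover have "x < (eta ^^ Suc 0) ((nu ^^ Suc 0) x)" using eta_nu[of x] by simp
  ultimately show ?case using Suc by (cases "q = 0") (auto simp: funpow_swap1)
qed simp

text \<open>A lower bound for the end of every walk from \<open>x\<close> with \<open>q\<close> more noses than hollows.\<close>

definition net :: "int \<Rightarrow> int \<Rightarrow> int" where
  "net q x = (if 0 \<le> q then (nu ^^ nat q) x else (eta ^^ nat (- q)) x)"

lemma net_0 [simp]: "net 0 x = x"
  by (simp add: net_def)

lemma net_1 [simp]: "net 1 x = nu x"
  by (simp add: net_def)

lemma net_m1 [simp]: "net (- 1) x = eta x"
  by (simp add: net_def)

text \<open>For \<open>q \<ge> 0\<close> this is an equality. For negative \<open>q\<close> the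
  added nose cancels the last hollow, and by \<open>nu_eta\<close> a nose after a hollow ends beyond
  the point where the hollow began. \<open>eta_net\<close> is dual.\<close>

lemma nu_net: "net (q + 1) x \<le> nu (net q x)"
proof (cases "0 \<le> q")
  case True
  then show ?thesis by (simp add: net_def nat_add_distrib)
next
  case False
  then have "nat (- q) = Suc (nat (- q - 1))" "q = - 1 - int (nat (- q - 1))" by auto
  then obtain r where r: "nat (- q) = Suc r" "q = - 1 - int r" by blast
  then have "net (q + 1) x = (eta ^^ r) x" by (auto simp: net_def)
  moreover have "net q x = eta ((eta ^^ r) x)" using r by (auto simp: net_def)
  ultimately show ?thesis using nu_eta[of "(eta ^^ r) x"] by simp
qed

lemma eta_net: "net (q - 1) x \<le> eta (net q x)"
proof (cases "q \<le> 0")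
  case True
  then have "nat (1 - q) = Suc (nat (- q))" by simp
  then show ?thesis using True by (auto simp: net_def)
next
  case False
  then obtain r where r: "nat q = Suc r" "q = 1 + int r"
    by (metis int_nat_eq linorder_not_le nat_0_iff not0_implies_Suc of_nat_Suc order_less_imp_le)
  then have "net (q - 1) x = (nu ^^ r) x" by (auto simp: net_def)
  moreover have "net q x = nu ((nu ^^ r) x)" using r by (auto simp: net_def)
  ultimately show ?thesis using eta_nu[of "(nu ^^ r) x"] by simp
qed

text \<open>Here the extra nose comes first, not last, so the cancellation takes place under the
  remaining iterates and is carried through by their monotonicity. \<open>net_eta\<close> is
  dual.\<close>

lemma net_nu: "net (q + 1) x \<le> net q (nu x)"
proof (cases "0 \<le> q")
  case True
  then show ?thesis by (simp add: net_def nat_add_distrib funpow_swap1)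
next
  case False
  then have "nat (- q) = Suc (nat (- q - 1))" "q = - 1 - int (nat (- q - 1))" by auto
  then obtain r where r: "nat (- q) = Suc r" "q = - 1 - int r" by blast
  then have "net (q + 1) x = (eta ^^ r) x" by (auto simp: net_def)
  moreover have "net q (nu x) = (eta ^^ r) (eta (nu x))"
    using r by (auto simp: net_def funpow_swap1)
  ultimately show ?thesis using eta_nu[of x] funpow_mono[OF eta_mono, of x "eta (nu x)" r] by simp
qed

lemma net_eta: "net (q - 1) x \<le> net q (eta x)"
proof (cases "q \<le> 0")
  case True
  then have "nat (1 - q) = Suc (nat (- q))" by simp
  then show ?thesis using True by (auto simp: net_def funpow_swap1)
next
  case False
  then obtain r where r: "nat q = Suc r" "q = 1 + int r"
    by (metis int_nat_eq linorder_not_le nat_0_iff not0_implies_Suc of_nat_Suc order_less_imp_le)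
  then have "net (q - 1) x = (nu ^^ r) x" by (auto simp: net_def)
  moreover have "net q (eta x) = (nu ^^ r) (nu (eta x))"
    using r by (auto simp: net_def funpow_swap1)
  ultimately show ?thesis using nu_eta[of x] funpow_mono[OF nu_mono, of x "nu (eta x)" r] by simp
qed

lemma net_mono: "x \<le> y \<Longrightarrow> net q x \<le> net q y"
  by (simp add: net_def funpow_mono[OF nu_mono] funpow_mono[OF eta_mono])

lemma net_shift: "net q (x + n) = net q x + n"
  using funpow_shift[of nu n _ x 1, OF nu_shift] funpow_shift[of eta n _ x 1, OF eta_shift]
  by (simp add: net_def)


text \<open>By \<open>low\<close> the infimum is over a set bounded below. Putting an edge in front
  shifts the index by one, by \<open>net_nu\<close> and \<open>net_eta\<close>, so every term of the
  infimum at the head dominates a term of the infimum at the tail, corrected by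
  \<open>l\<close>.\<close>

lemma weak_potential:
  fixes l K :: real
  assumes low: "\<And>x q. real_of_int x - K \<le> real_of_int (net q x) - real_of_int q * l"
  obtains \<phi> :: "int \<Rightarrow> real" where "mono \<phi>" "\<And>x. \<phi> (x + n) = \<phi> x + real_of_int n"
    "\<And>x. \<phi> x + l \<le> \<phi> (nu x)" "\<And>x. \<phi> x - l \<le> \<phi> (eta x)"
proof -
  define \<phi> where "\<phi> x = (INF q. real_of_int (net q x) - real_of_int q * l)" for x
  have lower: "\<phi> x \<le> real_of_int (net q x) - real_of_int q * l" for x q
    unfolding \<phi>_def using low by (intro cINF_lower bdd_belowI2[where m = "real_of_int x - K"]) auto
  have greatest: "d \<le> \<phi> x" if "\<And>q. d \<le> real_of_int (net q x) - real_of_int q * l" for d x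
    unfolding \<phi>_def using that by (intro cINF_greatest) auto
  show ?thesis
  proof (rule that[of \<phi>])
    show "mono \<phi>"
    proof (rule monoI, rule greatest)
      fix x y q :: int assume "x \<le> y"
      then have "real_of_int (net q x) \<le> real_of_int (net q y)" using net_mono by simp
      then show "\<phi> x \<le> real_of_int (net q y) - real_of_int q * l" using lower[of x q] by linarith
    qed
    show "\<phi> (x + n) = \<phi> x + real_of_int n" for x
    proof (rule antisym)
      have "\<phi> (x + n) - real_of_int n \<le> \<phi> x"
      proof (rule greatest)
        fix q
        show "\<phi> (x + n) - real_of_int n \<le> real_of_int (net q x) - real_of_int q * l"
          using lower[of "x + n" q] by (simp add: net_shift)
      qed
      then show "\<phi> (x + n) \<le> \<phi> x + real_of_int n" by simp
      show "\<phi> x + real_of_int n \<le> \<phi> (x + n)"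
      proof (rule greatest)
        fix q
        show "\<phi> x + real_of_int n \<le> real_of_int (net q (x + n)) - real_of_int q * l"
          using lower[of x q] by (simp add: net_shift)
      qed
    qed
    show "\<phi> x + l \<le> \<phi> (nu x)" for x
    proof (rule greatest)
      fix q
      have "real_of_int (net (q + 1) x) \<le> real_of_int (net q (nu x))" using net_nu by simp
      then show "\<phi> x + l \<le> real_of_int (net q (nu x)) - real_of_int q * l"
        using lower[of x "q + 1"] by (simp add: algebra_simps)
    qed
    show "\<phi> x - l \<le> \<phi> (eta x)" for x
    proof (rule greatest)
      fix q
      have "real_of_int (net (q - 1) x) \<le> real_of_int (net q (eta x))" using net_eta by simp
      then show "\<phi> x - l \<le> real_of_int (net q (eta x)) - real_of_int q * l"
        using lower[of x "q - 1"] by (simp add: algebra_simps)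
    qed
  qed
qed

section \<open>Walks on the integers and tight closed walks\<close>

text \<open>\<open>q\<close> counts noses minus hollows. Noses and hollows are allowed from every
  \<open>x\<close>, whether or not the extremes are consecutive, so a potential for these moves
  controls all values of \<open>nu\<close> and \<open>eta\<close>.\<close>

definition move :: "int \<Rightarrow> int \<Rightarrow> int \<Rightarrow> bool" where
  "move x q y \<longleftrightarrow> (q = 0 \<and> y = x + 1) \<or> (q = 1 \<and> y = nu x) \<or> (q = - 1 \<and> y = eta x)"

lemma move_shift: "move x q y \<Longrightarrow> move (x + n * t) q (y + n * t)"
  using shift_multiple[of nu n n x t, OF nu_shift] shift_multiple[of eta n n x t, OF eta_shift]
  by (auto simp: move_def)

inductive moves :: "int \<Rightarrow> int \<Rightarrow> int \<Rightarrow> bool" for x where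
  moves_single: "move x q y \<Longrightarrow> moves x q y"
| moves_append: "moves x q y \<Longrightarrow> move y r z \<Longrightarrow> moves x (q + r) z"

text \<open>The strict part excludes closed walks with as many noses as hollows. If the last edge is
  a nose or a hollow, the walk before it has index \<open>- 1\<close> or \<open>1\<close>, and
  \<open>nu_eta\<close> or \<open>eta_nu\<close> gives strictness.\<close>

lemma moves_lower: "moves x q y \<Longrightarrow> net q x \<le> y \<and> (q = 0 \<longrightarrow> x < y)"
proof (induction rule: moves.induct)
  case (moves_single q y)
  then show ?case by (auto simp: move_def)
next
  case (moves_append q y r z)
  consider "r = 0" "z = y + 1" | "r = 1" "z = nu y" | "r = - 1" "z = eta y"
    using moves_append.hyps(2) by (auto simp: move_def)
  then show ?case
  proof cases
    case 1
    then show ?thesis using moves_append.IH by auto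
  next
    case 2
    have "nu (net q x) \<le> z" using moves_append.IH 2 monoD[OF nu_mono] by blast
    moreover have "x < nu (net q x)" if "q + 1 = 0"
    proof -
      have "q = - 1" using that by simp
      then show ?thesis using nu_eta[of x] by simp
    qed
    ultimately show ?thesis using nu_net[of q x] 2 by auto
  next
    case 3
    have "eta (net q x) \<le> z" using moves_append.IH 3 monoD[OF eta_mono] by blast
    moreover have "x < eta (net q x)" if "q - 1 = 0"
    proof -
      have "q = 1" using that by simp
      then show ?thesis using eta_nu[of x] by simp
    qed
    ultimately show ?thesis using eta_net[of q x] 3 by auto
  qed
qed

lemma move_weak_potential:
  assumes "move x q y" "mono \<phi>" "\<And>x. \<phi> x + l \<le> \<phi> (nu x)" "\<And>x. \<phi> x - l \<le> \<phi> (eta x)"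
  shows "\<phi> x + real_of_int q * l \<le> (\<phi> y :: real)"
  using assms(1) assms(3,4)[of x] monoD[OF assms(2), of x "x + 1"] by (auto simp: move_def)

lemma moves_weak_potential:
  assumes "moves x q y" "mono \<phi>" "\<And>x. \<phi> x + l \<le> \<phi> (nu x)" "\<And>x. \<phi> x - l \<le> \<phi> (eta x)"
  shows "\<phi> x + real_of_int q * l \<le> (\<phi> y :: real)"
  using assms(1)
proof (induction rule: moves.induct)
  case (moves_single q y)
  then show ?case using move_weak_potential assms(2-) by blast
next
  case (moves_append q y r z)
  have "\<phi> y + real_of_int r * l \<le> \<phi> z"
    using move_weak_potential[OF moves_append.hyps(2)] assms(2-) by blast
  then show ?case using moves_append.IH by (simp add: algebra_simps)
qed

lemma potential_mod:
  assumes "\<And>x. \<phi> (x + n) = \<phi> x + real_of_int n"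
  shows "\<phi> (y mod n) = \<phi> y - real_of_int n * real_of_int (y div n)"
  using shift_multiple[of \<phi> n "real_of_int n" "y mod n" "y div n", OF assms] by simp

text \<open>On average \<open>nu\<close> advances by \<open>\<beta>\<close> per nose and
  \<open>eta\<close> retreats by \<open>\<alpha>\<close> per hollow, and \<open>less\<close> says
  \<open>\<alpha> < \<beta>\<close>. Every \<open>l\<close> between them, bounds included, has a
  weak potential. For \<open>l\<close> strictly between, a tight closed walk would contradict the
  weak potential for \<open>\<alpha>\<close> or \<open>\<beta>\<close> or, if noses and hollows
  balance, \<open>moves_lower\<close>. Hence the tight edges modulo \<open>n\<close> are
  acyclic.\<close>

lemma strict_potential:
  assumes nose: "(nu ^^ k) z = z + n * m" "0 < k"
    and hollow: "(eta ^^ j) y = y - n * p" "0 < j"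
    and less: "p * int k < m * int j"
  obtains \<psi> :: "int \<Rightarrow> real" and l :: real where "\<And>x. \<psi> (x + n) = \<psi> x + real_of_int n"
    "\<And>x q y. move x q y \<Longrightarrow> \<psi> x + real_of_int q * l < \<psi> y"
proof -
  define \<alpha> where "\<alpha> = real_of_int (n * p) / real j"
  define \<beta> where "\<beta> = real_of_int (n * m) / real k"
  have "real_of_int (p * int k) < real_of_int (m * int j)" using less of_int_less_iff by blast
  then have "real_of_int n * real_of_int (p * int k) < real_of_int n * real_of_int (m * int j)"
    using n_pos by (intro mult_strict_left_mono) auto
  then have \<alpha>\<beta>: "\<alpha> < \<beta>"
    using nose(2) hollow(2) by (simp add: \<alpha>_def \<beta>_def field_simps)
  obtain K1 where K1: "\<And>x q. real_of_int x + real q * \<beta> - K1 \<le> real_of_int ((nu ^^ q) x)"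
    using funpow_lower_bound[OF nu_mono nu_shift n_pos nose] unfolding \<beta>_def by blast
  have "(eta ^^ j) y = y + n * (- p)" using hollow(1) by simp
  then obtain K2 where
    "\<And>x q. real_of_int x + real q * (real_of_int (n * (- p)) / real j) - K2 \<le> real_of_int ((eta ^^ q) x)"
    using funpow_lower_bound[OF eta_mono eta_shift n_pos _ hollow(2)] by blast
  then have K2: "real_of_int x - real q * \<alpha> - K2 \<le> real_of_int ((eta ^^ q) x)" for x q
    unfolding \<alpha>_def by (simp add: algebra_simps)
  \<comment> \<open>The growth of \<open>nu\<close> settles \<open>q \<ge> 0\<close> through
    \<open>l \<le> \<beta>\<close>, that of \<open>eta\<close> settles negative \<open>q\<close>
    through \<open>\<alpha> \<le> l\<close>.\<close>
  have low: "real_of_int x - max K1 K2 \<le> real_of_int (net q x) - real_of_int q * l"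
    if "\<alpha> \<le> l" "l \<le> \<beta>" for x q l
  proof (cases "0 \<le> q")
    case True
    have "real_of_int q * l \<le> real_of_int q * \<beta>" using True that by (intro mult_left_mono) auto
    moreover have "net q x = (nu ^^ nat q) x" "real (nat q) = real_of_int q"
      using True by (simp_all add: net_def)
    ultimately show ?thesis using K1[of x "nat q"] by (smt (verit))
  next
    case False
    have "real_of_int q * l \<le> real_of_int q * \<alpha>"
      using False that by (intro mult_left_mono_neg) auto
    moreover have "net q x = (eta ^^ nat (- q)) x" "real (nat (- q)) * \<alpha> = - (real_of_int q * \<alpha>)"
      using False by (simp_all add: net_def)
    ultimately show ?thesis using K2[of x "nat (- q)"] by (smt (verit))
  qed
  \<comment> \<open>The potentials for \<open>\<alpha>\<close> and \<open>\<beta>\<close> test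
    closed walks in \<open>no_tight\<close>; the one for the midpoint \<open>l\<close> is the one
    that gets perturbed.\<close>
  obtain \<phi>\<alpha> :: "int \<Rightarrow> real" where \<phi>\<alpha>: "mono \<phi>\<alpha>" "\<And>x. \<phi>\<alpha> (x + n) = \<phi>\<alpha> x + real_of_int n"
    "\<And>x. \<phi>\<alpha> x + \<alpha> \<le> \<phi>\<alpha> (nu x)" "\<And>x. \<phi>\<alpha> x - \<alpha> \<le> \<phi>\<alpha> (eta x)"
    by (rule weak_potential[of "max K1 K2" \<alpha>]) (use low[of \<alpha>] \<alpha>\<beta> in auto)
  obtain \<phi>\<beta> :: "int \<Rightarrow> real" where \<phi>\<beta>: "mono \<phi>\<beta>" "\<And>x. \<phi>\<beta> (x + n) = \<phi>\<beta> x + real_of_int n"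
    "\<And>x. \<phi>\<beta> x + \<beta> \<le> \<phi>\<beta> (nu x)" "\<And>x. \<phi>\<beta> x - \<beta> \<le> \<phi>\<beta> (eta x)"
    by (rule weak_potential[of "max K1 K2" \<beta>]) (use low[of \<beta>] \<alpha>\<beta> in auto)
  define l where "l = (\<alpha> + \<beta>) / 2"
  have l: "\<alpha> < l" "l < \<beta>" using \<alpha>\<beta> by (auto simp: l_def)
  obtain \<phi> :: "int \<Rightarrow> real" where \<phi>: "mono \<phi>" "\<And>x. \<phi> (x + n) = \<phi> x + real_of_int n"
    "\<And>x. \<phi> x + l \<le> \<phi> (nu x)" "\<And>x. \<phi> x - l \<le> \<phi> (eta x)"
    by (rule weak_potential[of "max K1 K2" l]) (use low[of l] l in auto)
  have mod: "\<phi> (y mod n) = \<phi> y - real_of_int n * real_of_int (y div n)" for y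
    by (rule potential_mod) (rule \<phi>)
  have no_tight: False if mv: "moves a q (a + n * t)" and eq: "real_of_int (n * t) = real_of_int q * l"
    for a q t
  proof -
    have \<alpha>: "real_of_int q * \<alpha> \<le> real_of_int (n * t)"
      using moves_weak_potential[OF mv \<phi>\<alpha>(1,3,4)] shift_multiple[of \<phi>\<alpha> n "real_of_int n" a t, OF \<phi>\<alpha>(2)]
      by simp
    have \<beta>: "real_of_int q * \<beta> \<le> real_of_int (n * t)"
      using moves_weak_potential[OF mv \<phi>\<beta>(1,3,4)] shift_multiple[of \<phi>\<beta> n "real_of_int n" a t, OF \<phi>\<beta>(2)]
      by simp
    consider "q = 0" | "0 < q" | "q < 0" by linarith
    then show False
    proof cases
      case 1
      then have "n * t = 0" using eq by simp
      moreover have "a < a + n * t" using moves_lower[OF mv] 1 by blast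
      ultimately show False by linarith
    next
      case 2
      then have "real_of_int q * l < real_of_int q * \<beta>" using l by simp
      then show False using \<beta> eq by simp
    next
      case 3
      then have "real_of_int q * l < real_of_int q * \<alpha>" using l by simp
      then show False using \<alpha> eq by simp
    qed
  qed
  \<comment> \<open>The finite quotient of the moves by translation by \<open>n\<close>: heads are
    reduced to residues, and the turns \<open>y div n\<close> dropped in this way are charged to the
    weight.\<close>
  define E where "E = (\<lambda>(x, q, y). (x, real_of_int q * l - real_of_int n * real_of_int (y div n), y mod n)) `
     {(x, q, y). x \<in> {0..<n} \<and> move x q y}"
  have "{(x, q, y). x \<in> {0..<n} \<and> move x q y} \<subseteq>
      (\<lambda>x. (x, 0, x + 1)) ` {0..<n} \<union> (\<lambda>x. (x, 1, nu x)) ` {0..<n} \<union> (\<lambda>x. (x, - 1, eta x)) ` {0..<n}"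
    by (auto simp: move_def)
  then have "finite {(x, q, y). x \<in> {0..<n} \<and> move x q y}"
    by (rule finite_subset) auto
  then have finE: "finite E" unfolding E_def by (rule finite_imageI)
  have weakE: "\<phi> a + w \<le> \<phi> b" if inE: "(a, w, b) \<in> E" for a w b
  proof -
    obtain q y where "move a q y" "w = real_of_int q * l - real_of_int n * real_of_int (y div n)"
      "b = y mod n"
      using inE by (auto simp: E_def)
    then show ?thesis using move_weak_potential[OF _ \<phi>(1,3,4), of a q y] mod[of y] by simp
  qed
  define R where "R = {(a, b). (a, \<phi> b - \<phi> a, b) \<in> E}"
  have RE: "\<exists>q y. a \<in> {0..<n} \<and> move a q y \<and> b = y mod n \<and> \<phi> y = \<phi> a + real_of_int q * l"
    if inR: "(a, b) \<in> R" for a b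
  proof -
    obtain q y where "a \<in> {0..<n}" "move a q y" "b = y mod n"
      "\<phi> b - \<phi> a = real_of_int q * l - real_of_int n * real_of_int (y div n)"
      using inR by (auto simp: R_def E_def)
    then show ?thesis using mod[of y] by (intro exI[of _ q] exI[of _ y]) simp
  qed
  \<comment> \<open>A path of tight edges between residues lifts to a walk on the integers that is
    tight as a whole.\<close>
  have path: "\<exists>q y. a \<in> {0..<n} \<and> moves a q y \<and> y mod n = b \<and> \<phi> y = \<phi> a + real_of_int q * l"
    if "(a, b) \<in> R\<^sup>+" for a b
    using that
  proof (induction rule: trancl_induct)
    case (base b)
    then show ?case using RE moves_single by blast
  next
    case (step b d)
    then obtain q y where y: "a \<in> {0..<n}" "moves a q y" "y mod n = b" "\<phi> y = \<phi> a + real_of_int q * l"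
      by blast
    obtain r z where z: "move b r z" "d = z mod n" "\<phi> z = \<phi> b + real_of_int r * l"
      using RE[OF step.hyps(2)] by blast
    \<comment> \<open>The next edge starts at the residue \<open>b\<close>; translating it by
      \<open>t\<close> turns makes it start at \<open>y\<close>.\<close>
    define t where "t = y div n"
    have yb: "y = b + n * t" using y(3) by (auto simp: t_def)
    then have "moves a (q + r) (z + n * t)" using moves_append[OF y(2)] move_shift[OF z(1)] by simp
    moreover have "(z + n * t) mod n = d" using z(2) by simp
    moreover have "\<phi> (z + n * t) = \<phi> a + real_of_int (q + r) * l"
    proof -
      have "\<phi> (z + n * t) = \<phi> z + real_of_int n * real_of_int t"
        "\<phi> (b + n * t) = \<phi> b + real_of_int n * real_of_int t"
        using shift_multiple[of \<phi> n "real_of_int n", OF \<phi>(2)] by blast+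
      then show ?thesis using y(4) z(3) yb by (simp add: algebra_simps)
    qed
    ultimately show ?case using y(1) by blast
  qed
  have "acyclic R"
    unfolding acyclic_def
  proof (intro allI notI)
    fix a assume "(a, a) \<in> R\<^sup>+"
    then obtain q y where y: "moves a q y" "y mod n = a" "\<phi> y = \<phi> a + real_of_int q * l"
      using path by blast
    have "y = a + n * (y div n)" using y(2) by (metis add.commute mult_div_mod_eq)
    moreover have "\<phi> (a + n * (y div n)) = \<phi> a + real_of_int n * real_of_int (y div n)"
      by (rule shift_multiple) (rule \<phi>(2))
    ultimately show False using no_tight[of a q "y div n"] y by simp
  qed
  then obtain \<psi>0 :: "int \<Rightarrow> real" where \<psi>0: "\<And>a w b. (a, w, b) \<in> E \<Longrightarrow> \<psi>0 a + w < \<psi>0 b"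
    using strict_potential_of_acyclic_tight[of E \<phi>] finE weakE unfolding R_def by blast
  \<comment> \<open>Extension from residues to all integers, with advance \<open>n\<close> per
    turn.\<close>
  define \<psi> where "\<psi> x = \<psi>0 (x mod n) + real_of_int n * real_of_int (x div n)" for x
  show ?thesis
  proof (rule that[of \<psi> l])
    show "\<psi> (x + n) = \<psi> x + real_of_int n" for x
      using n_pos by (simp add: \<psi>_def algebra_simps)
    show "\<psi> x + real_of_int q * l < \<psi> y" if "move x q y" for x q y
    proof -
      define t where "t = x div n"
      define y' where "y' = y - n * t"
      have x: "x + n * (- t) = x mod n" unfolding t_def by (simp add: minus_mult_div_eq_mod)
      have "move (x + n * (- t)) q (y + n * (- t))" using move_shift[OF that] .
      then have "move (x mod n) q y'" unfolding x by (simp add: y'_def)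
      then have "(x mod n, real_of_int q * l - real_of_int n * real_of_int (y' div n), y' mod n) \<in> E"
        unfolding E_def using n_pos by (intro image_eqI[where x = "(x mod n, q, y')"]) auto
      then have "\<psi>0 (x mod n) + (real_of_int q * l - real_of_int n * real_of_int (y' div n)) < \<psi>0 (y' mod n)"
        by (rule \<psi>0)
      moreover have y: "y = y' + n * t" by (simp add: y'_def)
      have "y mod n = y' mod n" "y div n = y' div n + t" using n_pos unfolding y by auto
      ultimately show ?thesis unfolding \<psi>_def t_def by (simp add: algebra_simps)
    qed
  qed
qed

section \<open>Unit realizations\<close>

text \<open>\<open>\<psi> x\<close> and \<open>\<psi> x + l\<close> are the lifted extremes of arc
  \<open>x\<close> on a circle of length \<open>c\<close>. The last two conditions place the end
  strictly between the starts of \<open>nu x - 1\<close> and \<open>nu x\<close>.\<close>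

definition unit_realization :: "(int \<Rightarrow> real) \<Rightarrow> real \<Rightarrow> real \<Rightarrow> bool" where
  "unit_realization \<psi> l c \<longleftrightarrow> strict_mono \<psi> \<and> (\<forall>x. \<psi> (x + n) = \<psi> x + c) \<and>
     (\<forall>x y. nu x \<le> y \<longrightarrow> \<psi> x + l < \<psi> y) \<and> (\<forall>x y. y < nu x \<longrightarrow> \<psi> y < \<psi> x + l)"

theorem unit_realization_exists:
  assumes "(nu ^^ k) z = z + n * m" "0 < k" "(eta ^^ j) y = y - n * p" "0 < j"
    and "p * int k < m * int j"
  obtains \<psi> l where "unit_realization \<psi> l (real_of_int n)"
proof -
  obtain \<psi> :: "int \<Rightarrow> real" and l where \<psi>: "\<And>x. \<psi> (x + n) = \<psi> x + real_of_int n"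
    and less: "\<And>x q y. move x q y \<Longrightarrow> \<psi> x + real_of_int q * l < \<psi> y"
    using strict_potential[OF assms] by blast
  have succ: "\<psi> x < \<psi> (x + 1)" and nu: "\<psi> x + l < \<psi> (nu x)" and eta: "\<psi> x - l < \<psi> (eta x)" for x
    using less[of x 0 "x + 1"] less[of x 1 "nu x"] less[of x "- 1" "eta x"] by (auto simp: move_def)
  have mono: "strict_mono \<psi>" by (rule int_strict_monoI) (rule succ)
  have "\<psi> x + l < \<psi> y" if "nu x \<le> y" for x y
    using nu[of x] strict_mono_less_eq[OF mono, of "nu x" y] that by linarith
  moreover have "\<psi> y < \<psi> x + l" if "y < nu x" for x y
  proof -
    \<comment> \<open>Noses bound starts from below; the bound from above comes from the hollow at
      \<open>y\<close>, whose head \<open>eta y\<close> is at most \<open>x\<close>.\<close>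
    have "eta y \<le> x" using adj[of x y] that by linarith
    then show ?thesis using eta[of y] strict_mono_less_eq[OF mono, of "eta y" x] by linarith
  qed
  ultimately show ?thesis using that \<psi> mono unfolding unit_realization_def by blast
qed

end

section \<open>Periodic paths on levels\<close>

lemma periodic_bounded:
  fixes g :: "int \<Rightarrow> real"
  assumes "0 < L" "\<And>i. g (i + L) = g i"
  obtains C where "\<And>i. \<bar>g i\<bar> \<le> C"
proof
  fix i
  have "g i = g (i mod L)"
    using shift_multiple[of g L 0 "i mod L" "i div L"] assms(2) by simp
  moreover have "\<bar>g (i mod L)\<bar> \<le> Max ((\<lambda>i. \<bar>g i\<bar>) ` {0..<L})"
    using \<open>0 < L\<close> by (intro Max_ge) auto
  ultimately show "\<bar>g i\<bar> \<le> Max ((\<lambda>i. \<bar>g i\<bar>) ` {0..<L})" by simp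
qed

text \<open>Finds the edge of a path above the position \<open>\<tau>\<close>: \<open>\<tau>\<close>
  falls into some period, and \<open>i\<close> is the last index of that period whose value is at
  most \<open>\<tau>\<close>.\<close>

lemma int_bracket:
  fixes f :: "int \<Rightarrow> real"
  assumes shift: "\<And>i. f (i + L) = f i + P" and "0 < P" "strict_mono f"
  obtains i where "f i \<le> \<tau>" "\<tau> < f (i + 1)"
proof -
  have f: "f (L * k) = f 0 + P * real_of_int k" for k
    using shift_multiple[of f L P 0 k, OF shift] by simp
  define k where "k = \<lfloor>(\<tau> - f 0) / P\<rfloor>"
  have "real_of_int k \<le> (\<tau> - f 0) / P" "(\<tau> - f 0) / P < real_of_int (k + 1)"
    unfolding k_def by linarith+
  then have a: "f (L * k) \<le> \<tau>" and b: "\<tau> < f (L * (k + 1))"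
    unfolding f using \<open>0 < P\<close> by (simp_all add: field_simps)
  define S where "S = {i. L * k \<le> i \<and> i \<le> L * (k + 1) \<and> f i \<le> \<tau>}"
  have ab: "L * k < L * (k + 1)"
    using a b strict_mono_less[OF \<open>strict_mono f\<close>, of "L * k" "L * (k + 1)"] by linarith
  have "finite S" by (rule finite_subset[of _ "{L * k..L * (k + 1)}"]) (auto simp: S_def)
  have "L * k \<in> S" using a ab by (simp add: S_def)
  define i where "i = Max S"
  have "i \<in> S" unfolding i_def using \<open>finite S\<close> \<open>L * k \<in> S\<close> by (intro Max_in) auto
  have "i + 1 \<notin> S" using Max_ge[OF \<open>finite S\<close>, of "i + 1"] unfolding i_def by linarith
  moreover have "i < L * (k + 1)"
    using \<open>i \<in> S\<close> b by (cases "i = L * (k + 1)") (auto simp: S_def)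
  ultimately have "\<tau> < f (i + 1)" using \<open>i \<in> S\<close> by (auto simp: S_def)
  then show ?thesis using that[of i] \<open>i \<in> S\<close> by (auto simp: S_def)
qed

text \<open>In the intended plane picture, positions on neighbouring levels compare starts with
  ends, which never coincide. On levels further apart positions may coincide, hence the restriction
  in \<open>pos_inj\<close>.\<close>

locale level_graph =
  fixes pos :: "'v \<Rightarrow> real" and lev :: "'v \<Rightarrow> int" and E :: "'v \<Rightarrow> 'v \<Rightarrow> bool"
  assumes pos_less: "\<And>a b. E a b \<Longrightarrow> pos a < pos b"
    and lev_diff: "\<And>a b. E a b \<Longrightarrow> \<bar>lev b - lev a\<bar> \<le> 1"
    and no_between: "\<And>a b d. E a b \<Longrightarrow> lev d = lev a \<Longrightarrow> pos a < pos d \<Longrightarrow> pos b \<le> pos d"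
    and pos_inj: "\<And>a b. pos a = pos b \<Longrightarrow> \<bar>lev a - lev b\<bar> \<le> 1 \<Longrightarrow> a = b"
begin

text \<open>
  Two disjoint paths cannot change sides: sweep both paths by increasing position and compare the
  levels of the edges met simultaneously.
\<close>

lemma disjoint_paths_same_side:
  fixes v w :: "int \<Rightarrow> 'v"
  assumes v: "\<And>i. E (v i) (v (i + 1))" and w: "\<And>j. E (w j) (w (j + 1))"
    and disj: "\<And>i j. v i \<noteq> w j"
    and start: "pos (v i0) < pos (w (j0 + 1))" "pos (w j0) < pos (v (i0 + 1))"
      "lev (v i0) < lev (w j0)"
  shows "i0 \<le> i \<Longrightarrow> j0 \<le> j \<Longrightarrow> pos (v i) < pos (w (j + 1)) \<Longrightarrow> pos (w j) < pos (v (i + 1)) \<Longrightarrow>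
    lev (v i) < lev (w j)"
proof (induction "nat ((i - i0) + (j - j0))" arbitrary: i j rule: less_induct)
  case less
  have mv: "strict_mono (\<lambda>i. pos (v i))" by (rule int_strict_monoI) (use pos_less v in blast)
  have mw: "strict_mono (\<lambda>i. pos (w i))" by (rule int_strict_monoI) (use pos_less w in blast)
  have v': "pos (v (i - 1)) < pos (v i)" "\<bar>lev (v i) - lev (v (i - 1))\<bar> \<le> 1"
    using pos_less[OF v[of "i - 1"]] lev_diff[OF v[of "i - 1"]] by simp_all
  have w': "pos (w (j - 1)) < pos (w j)" "\<bar>lev (w j) - lev (w (j - 1))\<bar> \<le> 1"
    using pos_less[OF w[of "j - 1"]] lev_diff[OF w[of "j - 1"]] by simp_all
  \<comment> \<open>Away from the initial pair, a path that has to step back has an earlier edge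
    left, because the initial edges overlap.\<close>
  have i: "i0 < i" if "i \<noteq> i0 \<or> j \<noteq> j0" "pos (w j) \<le> pos (v i)"
  proof (rule ccontr)
    assume "\<not> i0 < i"
    then have "i = i0" "j0 + 1 \<le> j" using that less.prems by auto
    then show False
      using start(1) that(2) strict_mono_less_eq[OF mw, of "j0 + 1" j] by simp
  qed
  have j: "j0 < j" if "i \<noteq> i0 \<or> j \<noteq> j0" "pos (v i) \<le> pos (w j)"
  proof (rule ccontr)
    assume "\<not> j0 < j"
    then have "j = j0" "i0 + 1 \<le> i" using that less.prems by auto
    then show False
      using start(2) that(2) strict_mono_less_eq[OF mv, of "i0 + 1" i] by simp
  qed
  \<comment> \<open>The path whose current vertex is further right steps back, or both at a tie.
    Levels change by at most one per edge, so in the second and third case only equal levels could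
    break the order, and those would put a vertex strictly inside an edge leaving its level. At a
    tie, levels at distance at most one would give a common vertex.\<close>
  consider "i = i0" "j = j0" | "i \<noteq> i0 \<or> j \<noteq> j0" "pos (w j) < pos (v i)"
    | "i \<noteq> i0 \<or> j \<noteq> j0" "pos (v i) < pos (w j)"
    | "i \<noteq> i0 \<or> j \<noteq> j0" "pos (v i) = pos (w j)"
    by linarith
  then show ?case
  proof cases
    case 1
    then show ?thesis using start by simp
  next
    case 2
    have "lev (v (i - 1)) < lev (w j)"
      using less.hyps[of "i - 1" j] less.prems i 2 v' by simp
    moreover have "lev (v i) \<noteq> lev (w j)"
      using no_between[OF w[of j], of "v i"] less.prems 2 by linarith
    ultimately show ?thesis using v' by linarith
  next
    case 3
    have "lev (v i) < lev (w (j - 1))"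
      using less.hyps[of i "j - 1"] less.prems j 3 w' by simp
    moreover have "lev (w j) \<noteq> lev (v i)"
      using no_between[OF v[of i], of "w j"] less.prems 3 by linarith
    ultimately show ?thesis using w' by linarith
  next
    case 4
    have "lev (v (i - 1)) < lev (w (j - 1))"
      using less.hyps[of "i - 1" "j - 1"] less.prems i j 4 v' w' by simp
    moreover have "\<not> \<bar>lev (v i) - lev (w j)\<bar> \<le> 1"
      using pos_inj[OF 4(2)] disj by blast
    ultimately show ?thesis using v' w' by linarith
  qed
qed

text \<open>The level minus its linear trend is periodic, hence bounded, and the tail of the edge
  above \<open>\<tau>\<close> is at most one edge length away from \<open>\<tau>\<close>. Everything
  is multiplied by \<open>P\<close> to avoid division.\<close>

lemma periodic_path_slope:
  fixes v :: "int \<Rightarrow> 'v" and L b :: int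
  assumes v: "\<And>i. E (v i) (v (i + 1))" and "0 < L"
    and pos: "\<And>i. pos (v (i + L)) = pos (v i) + P" and lev: "\<And>i. lev (v (i + L)) = lev (v i) + b"
  obtains C where "0 < P" "\<And>\<tau>. \<exists>i. pos (v i) \<le> \<tau> \<and> \<tau> < pos (v (i + 1)) \<and>
      \<bar>P * real_of_int (lev (v i)) - real_of_int b * \<tau>\<bar> \<le> C"
proof -
  have mono: "strict_mono (\<lambda>i. pos (v i))" by (rule int_strict_monoI) (use pos_less v in blast)
  have P: "0 < P" using strict_mono_less[OF mono, of 0 "0 + L"] pos[of 0] \<open>0 < L\<close> by simp
  obtain C where C: "\<And>i. \<bar>P * real_of_int (lev (v i)) - real_of_int b * pos (v i)\<bar> \<le> C"
    by (rule periodic_bounded[of L "\<lambda>i. P * real_of_int (lev (v i)) - real_of_int b * pos (v i)"])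
      (use \<open>0 < L\<close> in \<open>auto simp: pos lev algebra_simps\<close>)
  obtain G where G: "\<And>i. \<bar>pos (v (i + 1)) - pos (v i)\<bar> \<le> G"
  proof (rule periodic_bounded[of L "\<lambda>i. pos (v (i + 1)) - pos (v i)"])
    show "pos (v (i + L + 1)) - pos (v (i + L)) = pos (v (i + 1)) - pos (v i)" for i
      using pos[of i] pos[of "i + 1"] by (simp add: ac_simps)
  qed (use \<open>0 < L\<close> in auto)
  show ?thesis
  proof (rule that[OF P])
    fix \<tau>
    obtain i where i: "pos (v i) \<le> \<tau>" "\<tau> < pos (v (i + 1))"
      using int_bracket[of "\<lambda>i. pos (v i)" L P] pos P mono by blast
    have "\<bar>real_of_int b * (pos (v i) - \<tau>)\<bar> \<le> \<bar>real_of_int b\<bar> * G"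
      unfolding abs_mult using i G[of i] by (intro mult_left_mono) auto
    then have "\<bar>P * real_of_int (lev (v i)) - real_of_int b * \<tau>\<bar> \<le> C + \<bar>real_of_int b\<bar> * G"
      using C[of i] by (simp add: algebra_simps)
    then show "\<exists>i. pos (v i) \<le> \<tau> \<and> \<tau> < pos (v (i + 1)) \<and>
      \<bar>P * real_of_int (lev (v i)) - real_of_int b * \<tau>\<bar> \<le> C + \<bar>real_of_int b\<bar> * G"
      using i by blast
  qed
qed

text \<open>Far to the left the path of larger slope is below the other one, far to the right above
  it, which is impossible for disjoint paths.\<close>

lemma steeper_path_meets:
  fixes v w :: "int \<Rightarrow> 'v" and L L' b b' :: int
  assumes v: "\<And>i. E (v i) (v (i + 1))" "0 < L"
      "\<And>i. pos (v (i + L)) = pos (v i) + P" "\<And>i. lev (v (i + L)) = lev (v i) + b"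
    and w: "\<And>j. E (w j) (w (j + 1))" "0 < L'"
      "\<And>j. pos (w (j + L')) = pos (w j) + P'" "\<And>j. lev (w (j + L')) = lev (w j) + b'"
    and steeper: "real_of_int b' * P < real_of_int b * P'"
  shows "\<exists>i j. v i = w j"
proof (rule ccontr)
  assume "\<nexists>i j. v i = w j"
  then have disj: "\<And>i j. v i \<noteq> w j" by blast
  obtain C where P: "0 < P" and C: "\<And>\<tau>. \<exists>i. pos (v i) \<le> \<tau> \<and> \<tau> < pos (v (i + 1)) \<and>
      \<bar>P * real_of_int (lev (v i)) - real_of_int b * \<tau>\<bar> \<le> C"
    using periodic_path_slope[of v, OF v] by blast
  obtain C' where P': "0 < P'" and C': "\<And>\<tau>. \<exists>j. pos (w j) \<le> \<tau> \<and> \<tau> < pos (w (j + 1)) \<and>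
      \<bar>P' * real_of_int (lev (w j)) - real_of_int b' * \<tau>\<bar> \<le> C'"
    using periodic_path_slope[of w, OF w] by blast
  \<comment> \<open>\<open>D / (P * P')\<close> is the difference of the slopes.\<close>
  define D where "D = real_of_int b * P' - real_of_int b' * P"
  have D: "0 < D" using steeper by (simp add: D_def)
  define K where "K = P' * C + P * C'"
  have diff: "\<bar>P * P' * (real_of_int (lev (v i)) - real_of_int (lev (w j))) - D * \<tau>\<bar> \<le> K"
    if "\<bar>P * real_of_int (lev (v i)) - real_of_int b * \<tau>\<bar> \<le> C"
      "\<bar>P' * real_of_int (lev (w j)) - real_of_int b' * \<tau>\<bar> \<le> C'" for i j \<tau>
  proof -
    let ?x = "P * real_of_int (lev (v i)) - real_of_int b * \<tau>"
    let ?y = "P' * real_of_int (lev (w j)) - real_of_int b' * \<tau>"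
    have "P * P' * (real_of_int (lev (v i)) - real_of_int (lev (w j))) - D * \<tau> = P' * ?x - P * ?y"
      by (simp add: D_def algebra_simps)
    moreover have "\<bar>P' * ?x\<bar> \<le> P' * C" "\<bar>P * ?y\<bar> \<le> P * C'"
      unfolding abs_mult using that P P' by (simp_all add: mult_left_mono)
    ultimately show ?thesis unfolding K_def by linarith
  qed
  \<comment> \<open>Far enough out for the drift \<open>D * \<tau>\<close> to exceed the total error
    \<open>K\<close>.\<close>
  define \<tau> where "\<tau> = (\<bar>K\<bar> + 1) / D"
  have \<tau>: "D * \<tau> = \<bar>K\<bar> + 1" "0 < \<tau>" using D by (auto simp: \<tau>_def)
  obtain i0 where i0: "pos (v i0) \<le> - \<tau>" "- \<tau> < pos (v (i0 + 1))"
    "\<bar>P * real_of_int (lev (v i0)) - real_of_int b * (- \<tau>)\<bar> \<le> C" using C by blast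
  obtain j0 where j0: "pos (w j0) \<le> - \<tau>" "- \<tau> < pos (w (j0 + 1))"
    "\<bar>P' * real_of_int (lev (w j0)) - real_of_int b' * (- \<tau>)\<bar> \<le> C'" using C' by blast
  obtain i where i: "pos (v i) \<le> \<tau>" "\<tau> < pos (v (i + 1))"
    "\<bar>P * real_of_int (lev (v i)) - real_of_int b * \<tau>\<bar> \<le> C" using C by blast
  obtain j where j: "pos (w j) \<le> \<tau>" "\<tau> < pos (w (j + 1))"
    "\<bar>P' * real_of_int (lev (w j)) - real_of_int b' * \<tau>\<bar> \<le> C'" using C' by blast
  have mv: "strict_mono (\<lambda>i. pos (v i))" by (rule int_strict_monoI) (use pos_less v in blast)
  have mw: "strict_mono (\<lambda>i. pos (w i))" by (rule int_strict_monoI) (use pos_less w in blast)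
  have "P * P' * (real_of_int (lev (v i0)) - real_of_int (lev (w j0))) < 0"
    using diff[OF i0(3) j0(3)] \<tau>(1) by simp
  then have "lev (v i0) < lev (w j0)" using P P' by (simp add: mult_less_0_iff)
  moreover have "0 < P * P' * (real_of_int (lev (v i)) - real_of_int (lev (w j)))"
    using diff[OF i(3) j(3)] \<tau>(1) by simp
  then have "lev (w j) < lev (v i)" using mult_pos_pos[OF P P'] by (simp add: zero_less_mult_iff)
  moreover have "i0 \<le> i" using strict_mono_less[OF mv, of i0 "i + 1"] i0(1) i(2) \<tau>(2) by simp
  moreover have "j0 \<le> j" using strict_mono_less[OF mw, of j0 "j + 1"] j0(1) j(2) \<tau>(2) by simp
  ultimately show False
    using disjoint_paths_same_side[of v w i0 j0 i j, OF v(1) w(1) disj] i0 j0 i j by linarith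
qed

lemma nonparallel_paths_meet:
  fixes v w :: "int \<Rightarrow> 'v" and L L' b b' :: int
  assumes "\<And>i. E (v i) (v (i + 1))" "0 < L"
      "\<And>i. pos (v (i + L)) = pos (v i) + P" "\<And>i. lev (v (i + L)) = lev (v i) + b"
    and "\<And>j. E (w j) (w (j + 1))" "0 < L'"
      "\<And>j. pos (w (j + L')) = pos (w j) + P'" "\<And>j. lev (w (j + L')) = lev (w j) + b'"
    and "real_of_int b' * P \<noteq> real_of_int b * P'"
  shows "\<exists>i j. v i = w j"
proof (cases "real_of_int b' * P < real_of_int b * P'")
  case True
  then show ?thesis using steeper_path_meets[of v L P b w L' P' b'] assms by blast
next
  case False
  then have "real_of_int b * P' < real_of_int b' * P" using assms(9) by simp
  then show ?thesis using steeper_path_meets[of w L' P' b' v L P b] assms by metis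
qed

end

section \<open>The plane picture of a unit realization\<close>

context nose_hollow
begin

text \<open>The inequalities encode consecutive extremes: for a nose the next end comes after the
  start of \<open>nu x\<close>, for a hollow the next start comes after the end of
  \<open>eta x\<close>.\<close>

definition edge_move :: "int \<Rightarrow> int \<Rightarrow> int \<Rightarrow> bool" where
  "edge_move x q y \<longleftrightarrow> (q = 0 \<and> y = x + 1) \<or> (q = 1 \<and> y = nu x \<and> nu (x + 1) \<noteq> nu x) \<or>
     (q = - 1 \<and> y = eta x \<and> eta (x + 1) \<noteq> eta x)"

text \<open>Neighbouring levels are shifted by \<open>l\<close>, so comparing positions on them
  compares starts with ends. An arc \<open>z\<close> after \<open>x\<close> satisfies
  \<open>nu x < nu z\<close> when a nose leaves \<open>x\<close>, so the nose does not jump over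
  \<open>z\<close>; dually for hollows.\<close>

lemma level_graph_of_realization:
  assumes "unit_realization \<psi> l c"
  shows "level_graph (\<lambda>(x, u). \<psi> x - real_of_int u * l) snd (\<lambda>(x, u) (y, v). edge_move x (v - u) y)"
proof -
  have mono: "strict_mono \<psi>" and nose: "\<And>x y. nu x \<le> y \<Longrightarrow> \<psi> x + l < \<psi> y"
    and no_nose: "\<And>x y. y < nu x \<Longrightarrow> \<psi> y < \<psi> x + l"
    using assms by (auto simp: unit_realization_def)
  note less = strict_mono_less[OF mono] and le = strict_mono_less_eq[OF mono]
  have nose_iff: "\<psi> x + l < \<psi> y \<longleftrightarrow> nu x \<le> y" and hollow_iff: "\<psi> y < \<psi> x + l \<longleftrightarrow> eta y \<le> x" for x y
    using nose[of x y] no_nose[of y x] adj[of x y] by linarith+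
  have neq: "\<psi> x + l \<noteq> \<psi> y" for x y using nose[of x y] no_nose[of y x] by linarith
  have up: "nu x < nu (x + 1)" if "nu (x + 1) \<noteq> nu x" for x
    using monoD[OF nu_mono, of x "x + 1"] that by simp
  have down: "eta x < eta (x + 1)" if "eta (x + 1) \<noteq> eta x" for x
    using monoD[OF eta_mono, of x "x + 1"] that by simp
  have unified: "\<psi> x < \<psi> y - real_of_int q * l \<and> (\<forall>z. \<psi> x < \<psi> z \<longrightarrow> \<psi> y - real_of_int q * l \<le> \<psi> z)"
    if mv: "edge_move x q y" for x q y
  proof -
    consider "q = 0" "y = x + 1" | "q = 1" "y = nu x" "nu x < nu (x + 1)"
      | "q = - 1" "y = eta x" "eta x < eta (x + 1)"
      using mv up down by (auto simp: edge_move_def)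
    then show ?thesis
    proof cases
      case 1
      then show ?thesis by (auto simp: less le)
    next
      case 2
      have "\<psi> y - l \<le> \<psi> z" if "\<psi> x < \<psi> z" for z
      proof -
        have "x + 1 \<le> z" using that by (simp add: less)
        then have "\<not> nu z \<le> y" using monoD[OF nu_mono, of "x + 1" z] 2 by linarith
        then show ?thesis using nose_iff[of z y] by linarith
      qed
      then show ?thesis using 2 nose_iff[of x y] by auto
    next
      case 3
      have "\<psi> y + l \<le> \<psi> z" if "\<psi> x < \<psi> z" for z
      proof -
        have "x + 1 \<le> z" using that by (simp add: less)
        then have "\<not> eta z \<le> y" using monoD[OF eta_mono, of "x + 1" z] 3 by linarith
        then show ?thesis using hollow_iff[of z y] by linarith
      qed
      then show ?thesis using 3 hollow_iff[of x y] by auto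
    qed
  qed
  show ?thesis
  proof (unfold_locales, goal_cases)
    case (1 a b)
    then show ?case
      using unified[of "fst a" "snd b - snd a" "fst b"] by (auto simp: case_prod_beta algebra_simps)
  next
    case (2 a b)
    then show ?case by (auto simp: case_prod_beta edge_move_def)
  next
    case (3 a b d)
    then show ?case
      using unified[of "fst a" "snd b - snd a" "fst b"] by (auto simp: case_prod_beta algebra_simps)
  next
    case (4 a b)
    then consider "snd b = snd a" | "snd b = snd a + 1" | "snd a = snd b + 1" by linarith
    then show ?case
    proof cases
      case 1
      then show ?thesis using 4 strict_mono_eq[OF mono, of "fst a" "fst b"]
        by (auto simp: case_prod_beta prod_eq_iff)
    next
      case 2
      then show ?thesis using 4 neq[of "fst a" "fst b"] by (auto simp: case_prod_beta algebra_simps)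
    next
      case 3
      then show ?thesis using 4 neq[of "fst b" "fst a"] by (auto simp: case_prod_beta algebra_simps)
    qed
  qed
qed

end

section \<open>Unrolling a proper circular-arc model\<close>

lemma lift_less_iff:
  fixes e e' c :: real and a b :: int
  assumes "0 \<le> e" "e < c" "0 \<le> e'" "e' < c"
  shows "e + c * real_of_int a < e' + c * real_of_int b \<longleftrightarrow> a < b \<or> a = b \<and> e < e'"
proof -
  have less: "e + c * real_of_int a < e' + c * real_of_int b"
    if "0 \<le> e" "e < c" "0 \<le> e'" "e' < c" "a < b" for e e' and a b :: int
  proof -
    have "c * real_of_int (a + 1) \<le> c * real_of_int b"
      using that by (intro mult_left_mono) auto
    then show ?thesis using that by (simp add: algebra_simps)
  qed
  consider "a < b" | "a = b" | "b < a" by linarith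
  then show ?thesis using less[of e e' a b] less[of e' e b a] assms by cases auto
qed

lemma (in linorder) sorted_key_list_of_set_inj:
  assumes "inj_on f A" "finite A"
  shows "set (sorted_key_list_of_set f A) = A" "length (sorted_key_list_of_set f A) = card A"
    "sorted_wrt (<) (map f (sorted_key_list_of_set f A))"
proof -
  interpret folding_insort_key "(\<le>)" "(<)" A f
    by unfold_locales (rule assms)
  show "set (sorted_key_list_of_set f A) = A" "length (sorted_key_list_of_set f A) = card A"
    "sorted_wrt (<) (map f (sorted_key_list_of_set f A))"
    using assms(2) by auto
qed

definition wrap :: "arc \<Rightarrow> int" where
  "wrap A = (if start A < stop A then 0 else 1)"

text \<open>The end of the lift of the arc that begins at \<open>start A\<close>; it is at least
  \<open>circ M\<close> for a wrapping arc.\<close>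

definition arc_end :: "ca_model \<Rightarrow> arc \<Rightarrow> real" where
  "arc_end M A = stop A + circ M * real_of_int (wrap A)"

lemma arc_end_length: "arc_end M A = start A + arc_length M A"
  by (simp add: arc_end_def arc_length_def wrap_def)

lemma arc_end_bounds:
  assumes "start A \<noteq> stop A" "0 \<le> start A" "start A < circ M" "0 \<le> stop A" "stop A < circ M"
  shows "start A < arc_end M A" "arc_end M A < start A + circ M"
  using assms by (auto simp: arc_end_def wrap_def)

lemma mem_arc_points:
  assumes "0 \<le> start A" "start A < circ M" "0 \<le> stop A" "stop A < circ M"
  shows "z \<in> arc_points M A \<longleftrightarrow> 0 \<le> z \<and> z < circ M \<and>
    (start A < z \<and> z < arc_end M A \<or> start A < z + circ M \<and> z + circ M < arc_end M A)"
  using assms by (auto simp: arc_points_def cw_arc_def arc_end_def wrap_def)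

text \<open>A forward move of at most \<open>n\<close> enters a new turn exactly when the residue
  fails to increase, equal residues meaning a full turn. This is how external edges are recognised
  on the line.\<close>

lemma div_of_forward:
  fixes n x y :: int
  assumes "x < y" "y \<le> x + n"
  shows "y div n = x div n + (if y mod n \<le> x mod n then 1 else 0)"
proof -
  have n: "0 < n" using assms by simp
  define a b where "a = x mod n" and "b = y mod n"
  have ab: "0 \<le> a" "a < n" "0 \<le> b" "b < n" using n by (auto simp: a_def b_def)
  have xy: "x = n * (x div n) + a" "y = n * (y div n) + b" by (auto simp: a_def b_def)
  define d where "d = y div n - x div n"
  have eq: "y - x = n * d + (b - a)" using xy unfolding d_def by (simp add: algebra_simps)
  have "0 \<le> d"
  proof (rule ccontr)
    assume "\<not> 0 \<le> d"
    then have "n * d \<le> n * (- 1)" using n by (intro mult_left_mono) auto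
    then show False using eq ab assms by linarith
  qed
  moreover have "d \<le> 1"
  proof (rule ccontr)
    assume "\<not> d \<le> 1"
    then have "n * 2 \<le> n * d" using n by (intro mult_left_mono) auto
    then show False using eq ab assms by linarith
  qed
  ultimately consider "d = 0" | "d = 1" by linarith
  then show ?thesis
  proof cases
    case 1
    then have "a < b" using eq assms by simp
    then show ?thesis using 1 by (auto simp: d_def a_def b_def)
  next
    case 2
    then have "b \<le> a" using eq assms by simp
    then show ?thesis using 2 by (auto simp: d_def a_def b_def)
  qed
qed

lemma external_arc_iff:
  assumes "0 \<le> s" "s < circ M" "0 \<le> t"
  shows "external_arc M s t \<longleftrightarrow> t \<le> s"
  using assms by (auto simp: external_arc_def cw_arc_def)

lemma nose_in_synthetic_edges: "Edge A Nose B \<in> synthetic_edges M \<longleftrightarrow>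
    A \<in> arcs M \<and> B \<in> arcs M \<and> consecutive M (stop A) (start B)"
  and hollow_in_synthetic_edges: "Edge A Hollow B \<in> synthetic_edges M \<longleftrightarrow>
    A \<in> arcs M \<and> B \<in> arcs M \<and> consecutive M (start A) (stop B)"
  by ((cases A, cases B, simp add: synthetic_edges_def)+)

definition ext_weight :: "ca_model \<Rightarrow> edge \<Rightarrow> int" where
  "ext_weight M e = (if external_edge M e then (if kind e = Hollow then 1 else - 1) else 0)"

lemma Ext_eq_sum_list: "Ext M W = (\<Sum>e\<leftarrow>W. ext_weight M e)"
proof (induction W)
  case Nil
  then show ?case by (simp add: Ext_def count_external_def)
next
  case (Cons e W)
  then show ?case by (cases "kind e") (auto simp: Ext_def count_external_def ext_weight_def)
qed

text \<open>The change of level along an edge.\<close>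

definition balance :: "edge_kind \<Rightarrow> int" where
  "balance k = (case k of Step \<Rightarrow> 0 | Nose \<Rightarrow> 1 | Hollow \<Rightarrow> - 1)"

section \<open>Lifts of the arcs of a model to the line\<close>

locale pca =
  fixes M :: ca_model
  assumes pca: "PCA_model M" and nonempty: "arcs M \<noteq> {}"
begin

abbreviation "c \<equiv> circ M"

lemma c_pos: "0 < c"
  using pca by (simp add: PCA_model_def)

lemma start_range: "A \<in> arcs M \<Longrightarrow> 0 \<le> start A" "A \<in> arcs M \<Longrightarrow> start A < c"
  and stop_range: "A \<in> arcs M \<Longrightarrow> 0 \<le> stop A" "A \<in> arcs M \<Longrightarrow> stop A < c"
  using pca by (auto simp: PCA_model_def extremes_def subset_eq)

lemma stop_neq_start: "A \<in> arcs M \<Longrightarrow> B \<in> arcs M \<Longrightarrow> stop A \<noteq> start B"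
  using pca by (auto simp: PCA_model_def)

lemma not_contained: "A \<in> arcs M \<Longrightarrow> B \<in> arcs M \<Longrightarrow> A \<noteq> B \<Longrightarrow> \<not> arc_points M A \<subseteq> arc_points M B"
  using pca by (auto simp: PCA_model_def)

lemma end_bounds:
  assumes "A \<in> arcs M"
  shows "start A < arc_end M A" "arc_end M A < start A + c"
  using arc_end_bounds[of A M] start_range[OF assms] stop_range[OF assms]
    stop_neq_start[OF assms assms] by auto

text \<open>Two arcs with a common start would be nested.\<close>

lemma start_inj: "inj_on start (arcs M)"
proof (rule inj_onI, rule ccontr)
  fix A B assume AB: "A \<in> arcs M" "B \<in> arcs M" "start A = start B" "A \<noteq> B"
  have "arc_points M A \<subseteq> arc_points M B" if "arc_end M A \<le> arc_end M B"
      "A \<in> arcs M" "B \<in> arcs M" "start A = start B" for A B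
    using that mem_arc_points[of A M] mem_arc_points[of B M] start_range stop_range by auto
  from this[of A B] this[of B A] show False
    using not_contained[of A B] not_contained[of B A] AB by (metis linear)
qed

text \<open>Otherwise the arcs are nested: \<open>B\<close> inside \<open>A\<close> in the first
  case, and in the second \<open>A\<close>, moved by a full turn, inside \<open>B\<close>.\<close>

lemma end_order:
  assumes AB: "A \<in> arcs M" "B \<in> arcs M" "start A < start B"
  shows "arc_end M A < arc_end M B" "arc_end M B < arc_end M A + c"
proof -
  have "A \<noteq> B" using AB by auto
  note A = mem_arc_points[OF start_range(1,2)[OF AB(1)] stop_range(1,2)[OF AB(1)]]
  note B = mem_arc_points[OF start_range(1,2)[OF AB(2)] stop_range(1,2)[OF AB(2)]]
  show "arc_end M A < arc_end M B"
  proof (rule ccontr)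
    assume "\<not> arc_end M A < arc_end M B"
    then have "arc_points M B \<subseteq> arc_points M A" using AB(3) by (auto simp: A B)
    then show False using not_contained AB \<open>A \<noteq> B\<close> by blast
  qed
  show "arc_end M B < arc_end M A + c"
  proof (rule ccontr)
    assume "\<not> arc_end M B < arc_end M A + c"
    then have "arc_points M A \<subseteq> arc_points M B"
      using end_bounds[OF AB(2)] start_range[OF AB(2)] by (auto simp: A B)
    then show False using not_contained AB \<open>A \<noteq> B\<close> by blast
  qed
qed

definition n :: int where "n = int (card (arcs M))"

lemma fin: "finite (arcs M)"
  using pca by (simp add: PCA_model_def)

lemma n_pos: "0 < n"
  using fin nonempty by (simp add: n_def card_gt_0_iff)

lemma arc_list_props: "set (arc_list M) = arcs M" "length (arc_list M) = card (arcs M)"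
    "sorted_wrt (<) (map start (arc_list M))"
  using sorted_key_list_of_set_inj[OF start_inj fin] by (simp_all add: arc_list_def)

text \<open>Integers number the lifts: \<open>x mod n\<close> selects the arc,
  \<open>x div n\<close> is the turn in which the lift starts.\<close>

definition arc :: "int \<Rightarrow> arc" where "arc x = arc_list M ! nat (x mod n)"

lemma nat_mod_less: "nat (x mod n) < length (arc_list M)"
  using pos_mod_bound[OF n_pos, of x] pos_mod_sign[OF n_pos, of x] arc_list_props(2)
  unfolding n_def by linarith

lemma arc_in [simp]: "arc x \<in> arcs M"
  using nth_mem[OF nat_mod_less] by (simp add: arc_def arc_list_props)

lemma arc_shift [simp]: "arc (x + n * t) = arc x"
  by (simp add: arc_def)

lemma arc_shift1 [simp]: "arc (x + n) = arc x"
  by (simp add: arc_def)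

lemma start_arc_less: "start (arc x) < start (arc y) \<longleftrightarrow> x mod n < y mod n"
proof -
  have less: "start (arc x) < start (arc y)" if "x mod n < y mod n" for x y
  proof -
    have "nat (x mod n) < nat (y mod n)" using that pos_mod_sign[OF n_pos, of x] by (simp add: nat_less_eq_zless)
    then have "map start (arc_list M) ! nat (x mod n) < map start (arc_list M) ! nat (y mod n)"
      using arc_list_props(3) nat_mod_less[of y] by (intro sorted_wrt_nth_less[of "(<)"]) auto
    then show ?thesis using nat_mod_less by (simp add: arc_def)
  qed
  have "start (arc x) = start (arc y)" if "x mod n = y mod n" using that by (simp add: arc_def)
  then show ?thesis using less[of x y] less[of y x] by linarith
qed

lemma arc_eq_iff: "arc x = arc y \<longleftrightarrow> x mod n = y mod n"
  using start_arc_less[of x y] start_arc_less[of y x] by (auto simp: arc_def)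

lemma arc_surj:
  assumes "A \<in> arcs M"
  obtains x where "arc x = A" "0 \<le> x" "x < n"
proof -
  obtain i where "i < length (arc_list M)" "arc_list M ! i = A"
    using assms arc_list_props(1) by (metis in_set_conv_nth)
  then show ?thesis using that[of "int i"] by (simp add: arc_def n_def arc_list_props)
qed

definition s :: "int \<Rightarrow> real" where
  "s x = start (arc x) + c * real_of_int (x div n)"

definition T :: "int \<Rightarrow> real" where
  "T x = arc_end M (arc x) + c * real_of_int (x div n)"

lemma T_alt: "T x = stop (arc x) + c * real_of_int (x div n + wrap (arc x))"
  by (simp add: T_def arc_end_def algebra_simps)

lemma s_shift: "s (x + n) = s x + c" and T_shift: "T (x + n) = T x + c"
  using n_pos by (simp_all add: s_def T_def algebra_simps)

text \<open>The values over one period fit into a window shorter than \<open>c\<close>, so different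
  turns do not interleave.\<close>

lemma lift_strict_mono:
  fixes g :: "int \<Rightarrow> real"
  assumes "\<And>x. g (x + n) = g x + c"
    and "\<And>x y. 0 \<le> x \<Longrightarrow> x < y \<Longrightarrow> y < n \<Longrightarrow> g x < g y \<and> g y < g x + c"
  shows "strict_mono g"
proof (rule strict_monoI)
  fix x y :: int assume "x < y"
  have g: "g z = g (z mod n) + c * real_of_int (z div n)" for z
    using shift_multiple[of g n c "z mod n" "z div n", OF assms(1)] by simp
  have m: "0 \<le> x mod n" "x mod n < n" "0 \<le> y mod n" "y mod n < n" using n_pos by auto
  have gap: "g (x mod n) < g (y mod n) + c"
    using assms(2)[of "x mod n" "y mod n"] assms(2)[of "y mod n" "x mod n"] m c_pos
    by (cases "x mod n" "y mod n" rule: linorder_cases) auto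
  have "x div n \<le> y div n" using \<open>x < y\<close> n_pos by (simp add: zdiv_mono1)
  then consider "x div n = y div n" | "x div n + 1 \<le> y div n" by linarith
  then show "g x < g y"
  proof cases
    case 1
    have "x mod n < y mod n"
      using \<open>x < y\<close> mult_div_mod_eq[of n x] mult_div_mod_eq[of n y] unfolding 1 by linarith
    then show ?thesis using assms(2)[of "x mod n" "y mod n"] m g[of x] g[of y] 1 by simp
  next
    case 2
    then have "c * real_of_int (x div n + 1) \<le> c * real_of_int (y div n)"
      using c_pos by (intro mult_left_mono) auto
    then show ?thesis using gap g[of x] g[of y] by (simp add: algebra_simps)
  qed
qed

lemma s_mono: "strict_mono s"
proof (rule lift_strict_mono[of s, OF s_shift])
  fix x y assume "0 \<le> x" "x < y" "y < n"
  then show "s x < s y \<and> s y < s x + c"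
    using start_arc_less[of x y] start_range[of "arc x"] start_range[of "arc y"]
    by (simp add: s_def div_pos_pos_trivial mod_pos_pos_trivial)
qed

lemma T_mono: "strict_mono T"
proof (rule lift_strict_mono[of T, OF T_shift])
  fix x y assume "0 \<le> x" "x < y" "y < n"
  then show "T x < T y \<and> T y < T x + c"
    using start_arc_less[of x y] end_order[of "arc x" "arc y"]
    by (simp add: T_def div_pos_pos_trivial mod_pos_pos_trivial)
qed

lemmas s_less = strict_mono_less[OF s_mono] and T_less = strict_mono_less[OF T_mono]
lemmas s_le = strict_mono_less_eq[OF s_mono] and T_le = strict_mono_less_eq[OF T_mono]

lemma s_less_T: "s x < T x" and T_less_s: "T x < s x + c"
  using end_bounds[of "arc x"] by (simp_all add: s_def T_def)

lemma T_less_s_iff: "T x < s y \<longleftrightarrow> x div n + wrap (arc x) < y div n \<or>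
    x div n + wrap (arc x) = y div n \<and> stop (arc x) < start (arc y)"
  unfolding T_alt s_def by (rule lift_less_iff) (auto simp: start_range stop_range)

lemma s_less_T_iff: "s y < T x \<longleftrightarrow> y div n < x div n + wrap (arc x) \<or>
    y div n = x div n + wrap (arc x) \<and> start (arc y) < stop (arc x)"
  unfolding T_alt s_def by (rule lift_less_iff) (auto simp: start_range stop_range)

lemma T_neq_s: "T x \<noteq> s y"
  using T_less_s_iff[of x y] s_less_T_iff[of y x] stop_neq_start[of "arc x" "arc y"] by auto

section \<open>The maps \<open>nu\<close> and \<open>eta\<close> of a model\<close>

definition nu :: "int \<Rightarrow> int" where
  "nu x = x + int (LEAST k. T x < s (x + int k))"

text \<open>The search may start at \<open>x - n\<close>: that arc, and with it every earlier one,
  ends before \<open>s x\<close>.\<close>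

definition eta :: "int \<Rightarrow> int" where
  "eta x = x - n + int (LEAST k. s x < T (x - n + int k))"

lemma nu_le_iff: "nu x \<le> y \<longleftrightarrow> T x < s y"
proof
  have "T x < s (x + int (nat n))" using T_less_s[of x] s_shift[of x] n_pos by simp
  then have "T x < s (nu x)" unfolding nu_def by (rule LeastI)
  then show "T x < s y" if "nu x \<le> y" using that s_le[of "nu x" y] by simp
next
  assume *: "T x < s y"
  then have "x < y" using s_less_T[of x] s_less[of x y] by simp
  then have "T x < s (x + int (nat (y - x)))" using * by simp
  then have "(LEAST k. T x < s (x + int k)) \<le> nat (y - x)" by (rule Least_le)
  then show "nu x \<le> y" unfolding nu_def using \<open>x < y\<close> by linarith
qed

lemma eta_le_iff: "eta x \<le> y \<longleftrightarrow> s x < T y"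
proof
  have "s x < T (x - n + int (nat n))" using s_less_T[of x] n_pos by simp
  then have "s x < T (eta x)" unfolding eta_def by (rule LeastI)
  then show "s x < T y" if "eta x \<le> y" using that T_le[of "eta x" y] by simp
next
  assume *: "s x < T y"
  have "T (x - n) < s x" using T_less_s[of x] T_shift[of "x - n"] by simp
  then have "x - n < y" using * T_less[of "x - n" y] by simp
  then have "s x < T (x - n + int (nat (y - (x - n))))" using * by simp
  then have "(LEAST k. s x < T (x - n + int k)) \<le> nat (y - (x - n))" by (rule Least_le)
  then show "eta x \<le> y" unfolding eta_def using \<open>x - n < y\<close> by linarith
qed

text \<open>\<open>adj\<close> holds because starts and ends are distinct, so
  \<open>T k < s m\<close> and \<open>s m < T k\<close> are complementary. The bounds on
  \<open>nu\<close> say that a lifted arc has positive length less than \<open>c\<close>.\<close>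

sublocale nose_hollow n nu eta
proof
  show "0 < n" by (rule n_pos)
  show "nu k \<le> m \<longleftrightarrow> k < eta m" for k m
    using nu_le_iff[of k m] eta_le_iff[of m k] T_neq_s[of k m] by linarith
  show "nu (m + n) = nu m + n" for m
  proof -
    have "nu (m + n) \<le> k \<longleftrightarrow> nu m + n \<le> k" for k
      using nu_le_iff[of "m + n" k] nu_le_iff[of m "k - n"] s_shift[of "k - n"] T_shift[of m]
      by simp linarith
    from this[of "nu m + n"] this[of "nu (m + n)"] show ?thesis by linarith
  qed
  show "m < nu m" for m using nu_le_iff[of m m] s_less_T[of m] by linarith
  show "nu m \<le> m + n" for m using nu_le_iff[of m "m + n"] T_less_s[of m] s_shift[of m] by simp
qed

lemma lifted_extremes:
  "(\<exists>z\<in>extremes M. \<exists>k. w = z + c * real_of_int k) \<longleftrightarrow> w \<in> range s \<union> range T"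
proof
  assume "\<exists>z\<in>extremes M. \<exists>k. w = z + c * real_of_int k"
  then obtain A k where A: "A \<in> arcs M" "w = start A + c * real_of_int k \<or> w = stop A + c * real_of_int k"
    by (auto simp: extremes_def)
  obtain x where x: "arc x = A" "0 \<le> x" "x < n" using arc_surj[OF A(1)] .
  have "x div n = 0" using x by simp
  \<comment> \<open>The copy of \<open>stop A\<close> in turn \<open>k\<close> ends the lift of
    \<open>A\<close> that starts \<open>wrap A\<close> turns earlier.\<close>
  then have "s (x + n * k) = start A + c * real_of_int k"
    "T (x + n * (k - wrap A)) = stop A + c * real_of_int k"
    unfolding s_def T_alt arc_shift x(1) using n_pos by simp_all
  then show "w \<in> range s \<union> range T" using A(2) by (metis Un_iff rangeI)
next
  have "start (arc x) \<in> extremes M" "stop (arc x) \<in> extremes M" for x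
    by (simp_all add: extremes_def)
  moreover assume "w \<in> range s \<union> range T"
  then obtain x where "w = s x \<or> w = T x" by blast
  ultimately show "\<exists>z\<in>extremes M. \<exists>k. w = z + c * real_of_int k"
    unfolding s_def T_alt by blast
qed

section \<open>Edges of the synthetic graph on the line\<close>

text \<open>A window shorter than a full turn projects injectively to the circle, so the extremes
  inside the circular arc are the projections of the lifted extremes inside the window.\<close>

lemma consecutive_iff:
  assumes e: "0 \<le> e" "e < c" "0 \<le> e'" "e' < c"
    and E: "E = e + c * real_of_int q" "E' = e' + c * real_of_int q'"
    and less: "E < E'" "E' < E + c"
  shows "consecutive M e e' \<longleftrightarrow> (\<forall>w\<in>range s \<union> range T. \<not> (E < w \<and> w < E'))"
proof -
  have ext: "0 \<le> z" "z < c" if "z \<in> extremes M" for z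
    using that pca by (auto simp: PCA_model_def)
  \<comment> \<open>Lifts this close lie in the same turn, or in successive turns when the arc
    passes the distinguished point.\<close>
  have q: "q' = q \<and> e < e' \<or> q' = q + 1 \<and> e' < e"
  proof -
    have "q < q' \<or> q = q' \<and> e < e'"
      using less(1) lift_less_iff[OF e, of q q'] unfolding E by simp
    moreover have "e' + c * real_of_int q' < e + c * real_of_int (q + 1)"
      using less(2) unfolding E by (simp add: algebra_simps)
    then have "q' < q + 1 \<or> q' = q + 1 \<and> e' < e"
      using lift_less_iff[OF e(3,4,1,2), of q' "q + 1"] by simp
    ultimately show ?thesis by linarith
  qed
  have "z \<in> cw_arc M e e' \<longleftrightarrow> (\<exists>k. E < z + c * real_of_int k \<and> z + c * real_of_int k < E')"
    if z: "z \<in> extremes M" for z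
  proof -
    have "E < z + c * real_of_int k \<longleftrightarrow> q < k \<or> q = k \<and> e < z" for k
      unfolding E by (rule lift_less_iff) (use e ext[OF z] in auto)
    moreover have "z + c * real_of_int k < E' \<longleftrightarrow> k < q' \<or> k = q' \<and> z < e'" for k
      unfolding E by (rule lift_less_iff) (use e ext[OF z] in auto)
    ultimately have *: "(\<exists>k. E < z + c * real_of_int k \<and> z + c * real_of_int k < E') \<longleftrightarrow>
      (\<exists>k. (q < k \<or> q = k \<and> e < z) \<and> (k < q' \<or> k = q' \<and> z < e'))" by simp
    show ?thesis
    proof (cases "e < e'")
      case True
      then have "q' = q" using q by auto
      then show ?thesis unfolding * using True by (auto simp: cw_arc_def)
    next
      case False
      then have q': "q' = q + 1" using q by auto
      have "(\<exists>k. (q < k \<or> q = k \<and> e < z) \<and> (k < q' \<or> k = q' \<and> z < e')) \<longleftrightarrow> e < z \<or> z < e'"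
        unfolding q' by (auto intro: exI[of _ q] exI[of _ "q + 1"])
      then show ?thesis unfolding * using False ext[OF z] by (auto simp: cw_arc_def)
    qed
  qed
  then have "consecutive M e e' \<longleftrightarrow>
      (\<forall>z\<in>extremes M. \<nexists>k. E < z + c * real_of_int k \<and> z + c * real_of_int k < E')"
    by (auto simp: consecutive_def)
  also have "\<dots> \<longleftrightarrow> (\<forall>w. (\<exists>z\<in>extremes M. \<exists>k. w = z + c * real_of_int k) \<longrightarrow> \<not> (E < w \<and> w < E'))"
    by blast
  finally show ?thesis unfolding lifted_extremes by blast
qed

lemma shift_into_window:
  assumes "\<And>x. g (x + n) = g x + c"
  obtains y where "arc y = arc x" "r < g y" "g y \<le> r + c"
proof -
  define k where "k = \<lfloor>(r - g x) / c\<rfloor> + 1"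
  have "(r - g x) / c < real_of_int k" "real_of_int k \<le> (r - g x) / c + 1"
    unfolding k_def by linarith+
  then have "r - g x < c * real_of_int k" "c * real_of_int k \<le> r - g x + c"
    using c_pos by (simp_all add: field_simps)
  then show ?thesis
    using that[of "x + n * k"] shift_multiple[of g n c x k, OF assms] by simp
qed

text \<open>No start in between makes \<open>y\<close> the first start after the end of
  \<open>x\<close>; no end in between means that arc \<open>x + 1\<close> ends after
  \<open>s y\<close>.\<close>

lemma nose_consecutive_iff:
  assumes "T x < s y" "s y < T x + c"
  shows "consecutive M (stop (arc x)) (start (arc y)) \<longleftrightarrow> y = nu x \<and> nu (x + 1) \<noteq> nu x"
proof -
  have "consecutive M (stop (arc x)) (start (arc y)) \<longleftrightarrow>
      (\<forall>w\<in>range s \<union> range T. \<not> (T x < w \<and> w < s y))"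
    by (rule consecutive_iff[OF _ _ _ _ T_alt s_def assms]) (auto simp: start_range stop_range)
  also have "\<dots> \<longleftrightarrow> (\<forall>z. \<not> (nu x \<le> z \<and> z < y)) \<and> (\<forall>z. \<not> (x < z \<and> nu z \<le> y))"
    by (auto simp: nu_le_iff s_less T_less)
  also have "\<dots> \<longleftrightarrow> y = nu x \<and> nu (x + 1) \<noteq> nu x"
  proof -
    have "nu x \<le> y" using assms(1) nu_le_iff by simp
    then have 1: "(\<forall>z. \<not> (nu x \<le> z \<and> z < y)) \<longleftrightarrow> y = nu x" by force
    have 2: "(\<forall>z. \<not> (x < z \<and> nu z \<le> y)) \<longleftrightarrow> \<not> nu (x + 1) \<le> y"
    proof
      assume *: "\<not> nu (x + 1) \<le> y"
      have "\<not> nu z \<le> y" if "x < z" for z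
        using monoD[OF nu_mono, of "x + 1" z] that * by linarith
      then show "\<forall>z. \<not> (x < z \<and> nu z \<le> y)" by blast
    qed auto
    show ?thesis unfolding 1 2 using monoD[OF nu_mono, of x "x + 1"] by auto
  qed
  finally show ?thesis .
qed

lemma hollow_consecutive_iff:
  assumes "s x < T y" "T y < s x + c"
  shows "consecutive M (start (arc x)) (stop (arc y)) \<longleftrightarrow> y = eta x \<and> eta (x + 1) \<noteq> eta x"
proof -
  have "consecutive M (start (arc x)) (stop (arc y)) \<longleftrightarrow>
      (\<forall>w\<in>range s \<union> range T. \<not> (s x < w \<and> w < T y))"
    by (rule consecutive_iff[OF _ _ _ _ s_def T_alt assms]) (auto simp: start_range stop_range)
  also have "\<dots> \<longleftrightarrow> (\<forall>z. \<not> (eta x \<le> z \<and> z < y)) \<and> (\<forall>z. \<not> (x < z \<and> eta z \<le> y))"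
    by (auto simp: eta_le_iff s_less T_less)
  also have "\<dots> \<longleftrightarrow> y = eta x \<and> eta (x + 1) \<noteq> eta x"
  proof -
    have "eta x \<le> y" using assms(1) eta_le_iff by simp
    then have 1: "(\<forall>z. \<not> (eta x \<le> z \<and> z < y)) \<longleftrightarrow> y = eta x" by force
    have 2: "(\<forall>z. \<not> (x < z \<and> eta z \<le> y)) \<longleftrightarrow> \<not> eta (x + 1) \<le> y"
    proof
      assume *: "\<not> eta (x + 1) \<le> y"
      have "\<not> eta z \<le> y" if "x < z" for z
        using monoD[OF eta_mono, of "x + 1" z] that * by linarith
      then show "\<forall>z. \<not> (x < z \<and> eta z \<le> y)" by blast
    qed auto
    show ?thesis unfolding 1 2 using monoD[OF eta_mono, of x "x + 1"] by auto
  qed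
  finally show ?thesis .
qed

lemma step_edge_iff: "Edge (arc x) Step B \<in> synthetic_edges M \<longleftrightarrow> B = arc (x + 1)"
proof -
  let ?m = "length (arc_list M)"
  have m: "int ?m = n" by (simp add: n_def arc_list_props)
  have nth: "arc_list M ! i = arc (int i)" if "i < ?m" for i
    using that by (simp add: arc_def m[symmetric])
  have next_nth: "arc_list M ! (Suc i mod ?m) = arc (int i + 1)" if "i < ?m" for i
  proof -
    have "(int i + 1) mod n = int (Suc i mod ?m)" by (simp add: zmod_int m add.commute)
    then show ?thesis by (simp add: arc_def)
  qed
  have "Edge (arc x) Step B \<in> synthetic_edges M \<longleftrightarrow>
      (\<exists>i < ?m. arc x = arc_list M ! i \<and> B = arc_list M ! (Suc i mod ?m))"
    by (auto simp: synthetic_edges_def)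
  also have "\<dots> \<longleftrightarrow> (\<exists>i < ?m. arc x = arc (int i) \<and> B = arc (int i + 1))"
    using nth next_nth by auto
  also have "\<dots> \<longleftrightarrow> B = arc (x + 1)"
  proof
    assume "\<exists>i < ?m. arc x = arc (int i) \<and> B = arc (int i + 1)"
    then show "B = arc (x + 1)" by (metis arc_eq_iff mod_add_left_eq)
  next
    assume "B = arc (x + 1)"
    moreover have "arc x = arc (int (nat (x mod n)))" "arc (x + 1) = arc (int (nat (x mod n)) + 1)"
      unfolding arc_eq_iff using n_pos by (simp_all add: mod_simps)
    ultimately show "\<exists>i < ?m. arc x = arc (int i) \<and> B = arc (int i + 1)"
      using nat_mod_less[of x] by blast
  qed
  finally show ?thesis .
qed

lemma nose_edge_iff:
  "Edge (arc x) Nose B \<in> synthetic_edges M \<longleftrightarrow> B = arc (nu x) \<and> nu (x + 1) \<noteq> nu x"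
proof
  assume "Edge (arc x) Nose B \<in> synthetic_edges M"
  then have B: "B \<in> arcs M" "consecutive M (stop (arc x)) (start B)"
    by (simp_all add: nose_in_synthetic_edges)
  obtain y0 where "arc y0 = B" using arc_surj[OF B(1)] by blast
  \<comment> \<open>The lift of \<open>B\<close> that starts within one turn after
    \<open>T x\<close>; the closed end of the window is excluded since starts and ends
    differ.\<close>
  then obtain y where y: "arc y = B" "T x < s y" "s y \<le> T x + c"
    using shift_into_window[of s y0 "T x", OF s_shift] by metis
  have "s y < T x + c" using y(3) T_neq_s[of "x + n" y] T_shift[of x] by simp
  then show "B = arc (nu x) \<and> nu (x + 1) \<noteq> nu x"
    using nose_consecutive_iff[of x y] y B by auto
next
  assume *: "B = arc (nu x) \<and> nu (x + 1) \<noteq> nu x"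
  have 1: "T x < s (nu x)" using nu_le_iff[of x "nu x"] by simp
  \<comment> \<open>The start before \<open>nu x\<close> precedes \<open>T x\<close>, which keeps
    \<open>s (nu x)\<close> within one turn of \<open>T x\<close>.\<close>
  have "\<not> T x < s (nu x - 1)" using nu_le_iff[of x "nu x - 1"] by simp
  moreover have "s (nu x) \<le> s (nu x - 1) + c"
    using s_shift[of "nu x - 1"] s_le[of "nu x" "nu x - 1 + n"] n_pos by simp
  ultimately have "s (nu x) < T x + c" using T_neq_s[of x "nu x - 1"] by linarith
  then show "Edge (arc x) Nose B \<in> synthetic_edges M"
    using nose_consecutive_iff[OF 1] * by (simp add: nose_in_synthetic_edges)
qed

lemma hollow_edge_iff:
  "Edge (arc x) Hollow B \<in> synthetic_edges M \<longleftrightarrow> B = arc (eta x) \<and> eta (x + 1) \<noteq> eta x"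
proof
  assume "Edge (arc x) Hollow B \<in> synthetic_edges M"
  then have B: "B \<in> arcs M" "consecutive M (start (arc x)) (stop B)"
    by (simp_all add: hollow_in_synthetic_edges)
  obtain y0 where "arc y0 = B" using arc_surj[OF B(1)] by blast
  then obtain y where y: "arc y = B" "s x < T y" "T y \<le> s x + c"
    using shift_into_window[of T y0 "s x", OF T_shift] by metis
  have "T y < s x + c" using y(3) T_neq_s[of y "x + n"] s_shift[of x] by simp
  then show "B = arc (eta x) \<and> eta (x + 1) \<noteq> eta x"
    using hollow_consecutive_iff[of x y] y B by auto
next
  assume *: "B = arc (eta x) \<and> eta (x + 1) \<noteq> eta x"
  have 1: "s x < T (eta x)" using eta_le_iff[of x "eta x"] by simp
  have "\<not> s x < T (eta x - 1)" using eta_le_iff[of x "eta x - 1"] by simp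
  moreover have "T (eta x) \<le> T (eta x - 1) + c"
    using T_shift[of "eta x - 1"] T_le[of "eta x" "eta x - 1 + n"] n_pos by simp
  ultimately have "T (eta x) < s x + c" using T_neq_s[of "eta x - 1" x] by linarith
  then show "Edge (arc x) Hollow B \<in> synthetic_edges M"
    using hollow_consecutive_iff[OF 1] * by (simp add: hollow_in_synthetic_edges)
qed

text \<open>An edge is external exactly when its lift changes turn, forwards for steps and noses and
  backwards for hollows. Hence the turn decreases by the contribution of the edge to
  \<open>Ext\<close>.\<close>

lemma lift_edge:
  assumes e: "e \<in> synthetic_edges M" and t: "tail e = arc x"
  obtains y where "head e = arc y" "y div n = x div n - ext_weight M e"
    "edge_move x (balance (kind e)) y"
proof -
  have range: "0 \<le> start (arc z)" "start (arc z) < c" for z by (auto simp: start_range)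
  have fwd: "y div n = x div n - ext_weight M e"
    if "x < y" "y \<le> x + n" "head e = arc y" "kind e \<noteq> Hollow" for y
  proof -
    have "external_edge M e \<longleftrightarrow> start (arc y) \<le> start (arc x)"
      using that(3,4) t external_arc_iff[of "start (arc x)" M "start (arc y)"] range
      by (cases "kind e") (auto simp: external_edge_def)
    also have "\<dots> \<longleftrightarrow> y mod n \<le> x mod n" using start_arc_less[of x y] by linarith
    finally show ?thesis using div_of_forward[OF that(1,2)] that(4) by (simp add: ext_weight_def)
  qed
  have e_eq: "e = Edge (arc x) (kind e) (head e)" using t by (cases e) auto
  show ?thesis
  proof (cases "kind e")
    case Step
    then have "head e = arc (x + 1)" using e e_eq step_edge_iff by metis
    then show ?thesis using that[of "x + 1"] fwd[of "x + 1"] Step n_pos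
      by (auto simp: balance_def edge_move_def)
  next
    case Nose
    then have "head e = arc (nu x)" "nu (x + 1) \<noteq> nu x" using e e_eq nose_edge_iff by metis+
    then show ?thesis using that[of "nu x"] fwd[of "nu x"] Nose nu_gt nu_le
      by (auto simp: balance_def edge_move_def)
  next
    case Hollow
    then have h: "head e = arc (eta x)" "eta (x + 1) \<noteq> eta x" using e e_eq hollow_edge_iff by metis+
    let ?y = "eta x"
    have "?y div n = x div n - ext_weight M e"
    proof (cases "?y = x")
      case True
      then have "head e = tail e" using h t by simp
      then show ?thesis using Hollow True by (simp add: ext_weight_def external_edge_def)
    next
      case False
      then have "?y < x" using eta_le[of x] by simp
      \<comment> \<open>Since \<open>x - n < eta x < x\<close>, the residues differ, so the
        comparison of starts has no tie.\<close>
      have yx: "?y mod n \<noteq> x mod n"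
      proof
        assume "?y mod n = x mod n"
        then have "n dvd x - ?y" by (metis mod_eq_dvd_iff)
        then show False using \<open>?y < x\<close> eta_gt[of x] zdvd_imp_le[of n "x - ?y"] by simp
      qed
      have "external_edge M e \<longleftrightarrow> tail e \<noteq> head e \<and> start (arc x) \<le> start (arc ?y)"
        using h t Hollow external_arc_iff[of "start (arc ?y)" M "start (arc x)"] range
        by (auto simp: external_edge_def)
      also have "\<dots> \<longleftrightarrow> x mod n \<le> ?y mod n"
        using start_arc_less[of ?y x] yx arc_eq_iff[of x ?y] t h by auto
      finally show ?thesis using div_of_forward[OF \<open>?y < x\<close>, of n] eta_gt[of x] Hollow
        by (simp add: ext_weight_def)
    qed
    then show ?thesis using that[of ?y] h Hollow by (auto simp: balance_def edge_move_def)
  qed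
qed

end

section \<open>Circuits, unit models and greedy cycles\<close>

text \<open>Partial sums of the weights along the two-sided periodic repetition of \<open>W\<close>,
  normalised to be 0 at index 0.\<close>

definition periodic_sum :: "('e \<Rightarrow> int) \<Rightarrow> 'e list \<Rightarrow> int \<Rightarrow> int" where
  "periodic_sum g W i =
     (\<Sum>e\<leftarrow>take (nat (i mod int (length W))) W. g e) + i div int (length W) * (\<Sum>e\<leftarrow>W. g e)"

lemma succ_div_mod:
  fixes i L :: int
  assumes "0 < L"
  shows "i mod L + 1 < L \<Longrightarrow> (i + 1) mod L = i mod L + 1 \<and> (i + 1) div L = i div L"
    and "\<not> i mod L + 1 < L \<Longrightarrow> (i + 1) mod L = 0 \<and> (i + 1) div L = i div L + 1 \<and> i mod L = L - 1"
proof -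
  have r: "0 \<le> i mod L" "i mod L < L" using assms by auto
  have i: "i = L * (i div L) + i mod L" by simp
  {
    assume "i mod L + 1 < L"
    moreover have "i + 1 = L * (i div L) + (i mod L + 1)" using i by linarith
    ultimately show "(i + 1) mod L = i mod L + 1 \<and> (i + 1) div L = i div L"
      using r int_mod_pos_eq[of "i + 1" L "i div L" "i mod L + 1"]
        int_div_pos_eq[of "i + 1" L "i div L" "i mod L + 1"] by simp
  }
  {
    assume "\<not> i mod L + 1 < L"
    then have e: "i mod L = L - 1" using r by simp
    then have "i + 1 = L * (i div L) + L" using i by linarith
    then have "i + 1 = L * (i div L + 1) + 0" by (simp add: distrib_left)
    then show "(i + 1) mod L = 0 \<and> (i + 1) div L = i div L + 1 \<and> i mod L = L - 1"
      using e assms int_mod_pos_eq[of "i + 1" L "i div L + 1" 0]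
        int_div_pos_eq[of "i + 1" L "i div L + 1" 0] by simp
  }
qed

lemma periodic_sum_succ:
  assumes "W \<noteq> []"
  shows "periodic_sum g W (i + 1) = periodic_sum g W i + g (W ! nat (i mod int (length W)))"
proof -
  define L where "L = int (length W)"
  have L: "0 < L" using assms by (simp add: L_def)
  have r: "0 \<le> i mod L" "i mod L < L" using L by auto
  have take: "(\<Sum>e\<leftarrow>take (Suc (nat (i mod L))) W. g e) =
      (\<Sum>e\<leftarrow>take (nat (i mod L)) W. g e) + g (W ! nat (i mod L))"
    using r by (subst take_Suc_conv_app_nth) (auto simp: L_def)
  show ?thesis
  proof (cases "i mod L + 1 < L")
    case True
    have "nat (i mod L + 1) = Suc (nat (i mod L))" using r by simp
    then show ?thesis using succ_div_mod(1)[OF L True] take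
      by (simp add: periodic_sum_def flip: L_def)
  next
    case False
    then have "Suc (nat (i mod L)) = length W" using r unfolding L_def by linarith
    then have "(\<Sum>e\<leftarrow>W. g e) = (\<Sum>e\<leftarrow>take (nat (i mod L)) W. g e) + g (W ! nat (i mod L))"
      using take by simp
    moreover have "(i + 1) mod L = 0" "(i + 1) div L = i div L + 1"
      using succ_div_mod(2)[OF L False] by auto
    ultimately show ?thesis
      by (simp add: periodic_sum_def algebra_simps flip: L_def)
  qed
qed

lemma periodic_sum_shift:
  assumes "W \<noteq> []"
  shows "periodic_sum g W (i + int (length W)) = periodic_sum g W i + (\<Sum>e\<leftarrow>W. g e)"
  using assms by (simp add: periodic_sum_def algebra_simps)

section \<open>Containment, covering and iteration\<close>

lemma mem_arc_points_lift:
  assumes A: "0 \<le> start A" "start A < circ M" "0 \<le> stop A" "stop A < circ M" "start A \<noteq> stop A"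
  shows "z - circ M * real_of_int \<lfloor>z / circ M\<rfloor> \<in> arc_points M A \<longleftrightarrow>
    (\<exists>k. start A < z + circ M * real_of_int k \<and> z + circ M * real_of_int k < arc_end M A)"
proof -
  define m where "m = \<lfloor>z / circ M\<rfloor>"
  define y where "y = z - circ M * real_of_int m"
  have c: "0 < circ M" using A by simp
  have "real_of_int m \<le> z / circ M" "z / circ M < real_of_int m + 1" unfolding m_def by linarith+
  then have y: "0 \<le> y" "y < circ M" using c by (simp_all add: y_def field_simps)
  have b: "arc_end M A < start A + circ M" using arc_end_bounds A by auto
  have z: "z + circ M * real_of_int k = y + circ M * real_of_int (k + m)" for k
    by (simp add: y_def algebra_simps)
  have range: "j = 0 \<or> j = 1"
    if "start A < y + circ M * real_of_int j" "y + circ M * real_of_int j < arc_end M A" for j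
  proof -
    have "circ M * real_of_int j < circ M * 2" "circ M * (- 1) < circ M * real_of_int j"
      using that b y A by linarith+
    then have "real_of_int j < 2" "- 1 < real_of_int j" using c by (simp_all only: mult_less_cancel_left_pos)
    then show ?thesis by linarith
  qed
  have "(\<exists>k. start A < z + circ M * real_of_int k \<and> z + circ M * real_of_int k < arc_end M A) \<longleftrightarrow>
    (\<exists>j. start A < y + circ M * real_of_int j \<and> y + circ M * real_of_int j < arc_end M A)"
    unfolding z by (metis diff_add_cancel)
  also have "\<dots> \<longleftrightarrow> start A < y \<and> y < arc_end M A \<or> start A < y + circ M \<and> y + circ M < arc_end M A"
  proof
    assume "\<exists>j. start A < y + circ M * real_of_int j \<and> y + circ M * real_of_int j < arc_end M A"
    then show "start A < y \<and> y < arc_end M A \<or> start A < y + circ M \<and> y + circ M < arc_end M A"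
      using range by fastforce
  next
    assume "start A < y \<and> y < arc_end M A \<or> start A < y + circ M \<and> y + circ M < arc_end M A"
    then show "\<exists>j. start A < y + circ M * real_of_int j \<and> y + circ M * real_of_int j < arc_end M A"
      by (auto intro: exI[of _ 0] exI[of _ 1])
  qed
  finally show ?thesis
    using mem_arc_points[OF A(1-4), of y] y unfolding y_def m_def by simp
qed

text \<open>On the line, the interval of \<open>A\<close> is covered by the translates of the
  interval of \<open>B\<close>. These are shorter than \<open>c\<close>, hence separated, so a
  single translate contains it, and equal lengths force equal starts.\<close>

lemma contained_same_length:
  assumes A: "0 \<le> start A" "start A < circ M" "0 \<le> stop A" "stop A < circ M" "start A \<noteq> stop A"
    and B: "0 \<le> start B" "start B < circ M" "0 \<le> stop B" "stop B < circ M" "start B \<noteq> stop B"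
    and sub: "arc_points M A \<subseteq> arc_points M B" and len: "arc_length M A = arc_length M B"
  shows "start A = start B"
proof -
  define c where "c = circ M"
  have c: "0 < c" using A by (simp add: c_def)
  have lift: "\<exists>k. start B < z + c * real_of_int k \<and> z + c * real_of_int k < arc_end M B"
    if "start A < z" "z < arc_end M A" for z
  proof -
    have "\<exists>k. start A < z + c * real_of_int k \<and> z + c * real_of_int k < arc_end M A"
      using that by (intro exI[of _ 0]) simp
    then show ?thesis
      using mem_arc_points_lift[OF A, of z] mem_arc_points_lift[OF B, of z] sub unfolding c_def by blast
  qed
  note bA = arc_end_bounds[OF A(5,1-4)] and bB = arc_end_bounds[OF B(5,1-4)]
  have no_mult: False if "0 < c * real_of_int k" "c * real_of_int k < c" for k
  proof -
    have "0 < k" using that(1) c by (simp add: zero_less_mult_iff)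
    moreover have "k < 1" using that(2) c by simp
    ultimately show False by linarith
  qed
  \<comment> \<open>The midpoint selects the translate of \<open>B\<close>.\<close>
  define z where "z = (start A + arc_end M A) / 2"
  have z: "start A < z" "z < arc_end M A" using bA by (auto simp: z_def)
  obtain k where k: "start B < z + c * real_of_int k" "z + c * real_of_int k < arc_end M B"
    using lift[OF z] by blast
  \<comment> \<open>If this translate began inside the interval of \<open>A\<close>, its first point
    would lie inside another translate of \<open>B\<close>, at a distance that is a multiple of
    \<open>c\<close> but less than \<open>c\<close>.\<close>
  have 1: "start B \<le> start A + c * real_of_int k"
  proof (rule ccontr)
    assume "\<not> ?thesis"
    then obtain j where j: "start B < start B - c * real_of_int k + c * real_of_int j"
      "start B - c * real_of_int k + c * real_of_int j < arc_end M B"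
      using lift[of "start B - c * real_of_int k"] k z by auto
    show False using no_mult[of "j - k"] j bB unfolding c_def by (simp add: right_diff_distrib)
  qed
  have 2: "arc_end M A + c * real_of_int k \<le> arc_end M B"
  proof (rule ccontr)
    assume "\<not> ?thesis"
    then obtain j where j: "start B < arc_end M B - c * real_of_int k + c * real_of_int j"
      "arc_end M B - c * real_of_int k + c * real_of_int j < arc_end M B"
      using lift[of "arc_end M B - c * real_of_int k"] k z by auto
    show False using no_mult[of "k - j"] j bB unfolding c_def by (simp add: right_diff_distrib)
  qed
  have "start B = start A + c * real_of_int k" using 1 2 len unfolding arc_end_length by linarith
  then show ?thesis
    using lift_less_iff[OF A(1,2) B(1,2), of k 0] lift_less_iff[OF B(1,2) A(1,2), of 0 k]
    unfolding c_def by simp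
qed

text \<open>Clockwise from \<open>start A\<close>, the arc \<open>A\<close> reaches past
  \<open>start B\<close> and then \<open>B\<close> past \<open>start A\<close>. The criterion
  depends only on the order of the extremes, so it can be moved between equivalent models.\<close>

lemma mutual_starts_cover:
  assumes "0 \<le> start A" "start A < circ M" "0 \<le> stop A" "stop A < circ M"
    and "0 \<le> start B" "start B < circ M" "0 \<le> stop B" "stop B < circ M"
    and "start A \<in> arc_points M B" "start B \<in> arc_points M A"
  shows "arc_points M A \<union> arc_points M B = {0..<circ M}"
  using assms by (auto simp: arc_points_def cw_arc_def split: if_splits)

text \<open>The pigeonhole principle gives a periodic point, and minimality of its period makes the
  orbit injective.\<close>

lemma iterate_cycle:
  assumes "finite V" "v \<in> V" and f: "\<And>a. a \<in> V \<Longrightarrow> f a \<in> V"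
  obtains u L where "u \<in> V" "0 < L" "(f ^^ L) u = u" "inj_on (\<lambda>i. (f ^^ i) u) {..<L}"
proof -
  have V: "(f ^^ i) a \<in> V" if "a \<in> V" for i a using that f by (induction i) auto
  have "\<not> inj_on (\<lambda>i. (f ^^ i) v) (UNIV :: nat set)"
  proof
    assume "inj_on (\<lambda>i. (f ^^ i) v) (UNIV :: nat set)"
    then have "finite (UNIV :: nat set)"
      using V[OF \<open>v \<in> V\<close>] \<open>finite V\<close> by (intro finite_imageD[of "\<lambda>i. (f ^^ i) v"]) (auto intro: finite_subset)
    then show False by simp
  qed
  then obtain a b where ab: "a < b" "(f ^^ a) v = (f ^^ b) v"
    unfolding inj_on_def by (metis linorder_neqE_nat)
  define u where "u = (f ^^ a) v"
  have "(f ^^ (b - a)) u = (f ^^ (b - a + a)) v" by (simp only: funpow_add u_def o_apply)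
  then have ex: "0 < b - a \<and> (f ^^ (b - a)) u = u" using ab by (simp add: u_def)
  define L where "L = (LEAST L. 0 < L \<and> (f ^^ L) u = u)"
  have L: "0 < L \<and> (f ^^ L) u = u" unfolding L_def using ex by (rule LeastI)
  have min: "L \<le> N" if "0 < N" "(f ^^ N) u = u" for N
    unfolding L_def using that by (intro Least_le) simp
  have less: False if "i < j" "j < L" "(f ^^ i) u = (f ^^ j) u" for i j
  proof -
    have "(f ^^ (L - j + i)) u = (f ^^ (L - j)) ((f ^^ i) u)" by (simp add: funpow_add)
    also have "\<dots> = (f ^^ (L - j + j)) u" using that(3) by (simp add: funpow_add)
    also have "\<dots> = u" using that(2) L by simp
    finally have "L \<le> L - j + i" using that by (intro min) auto
    then show False using that by linarith
  qed
  show ?thesis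
  proof (rule that[of u L])
    show "u \<in> V" unfolding u_def using V \<open>v \<in> V\<close> by blast
    show "inj_on (\<lambda>i. (f ^^ i) u) {..<L}"
      using less by (intro inj_onI) (metis lessThan_iff linorder_neqE_nat)
  qed (use L in auto)
qed

section \<open>Circuits as periodic paths\<close>

context pca
begin

text \<open>The edges are repeated periodically; \<open>x\<close> lifts their tails and
  \<open>u\<close> records the levels. Each tail is placed in the turn given by minus the partial
  sum of \<open>Ext\<close>, as \<open>lift_edge\<close> prescribes.\<close>

lemma lift_circuit:
  assumes W: "circuit M W"
  obtains L :: int and e :: "int \<Rightarrow> edge" and x u :: "int \<Rightarrow> int" and b :: int
  where "0 < L" "range e = set W" "walk_vertices W = range (\<lambda>i. tail (e i))"
    "\<And>i. arc (x i) = tail (e i)" "\<And>i. edge_move (x i) (balance (kind (e i))) (x (i + 1))"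
    "\<And>i. x (i + L) = x i - n * Ext M W"
    "\<And>i. u (i + 1) = u i + balance (kind (e i))" "\<And>i. u (i + L) = u i + b"
proof -
  define L where "L = int (length W)"
  have "W \<noteq> []" and edges: "set W \<subseteq> synthetic_edges M"
    and path: "\<And>i. Suc i < length W \<Longrightarrow> head (W ! i) = tail (W ! Suc i)"
    and closed: "head (last W) = tail (hd W)"
    using W by (auto simp: circuit_def walk_def)
  have L: "0 < L" using \<open>W \<noteq> []\<close> by (simp add: L_def)
  define e where "e i = W ! nat (i mod L)" for i
  have lt: "nat (i mod L) < length W" for i
    using pos_mod_bound[OF L, of i] pos_mod_sign[OF L, of i] unfolding L_def by linarith
  have eW: "e i \<in> set W" for i unfolding e_def using lt by simp
  have range_e: "range e = set W"
  proof
    show "set W \<subseteq> range e"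
    proof
      fix a assume "a \<in> set W"
      then obtain i where "i < length W" "a = W ! i" by (metis in_set_conv_nth)
      then have "a = e (int i)" by (simp add: e_def L_def)
      then show "a \<in> range e" by blast
    qed
  qed (use eW in blast)
  have ht: "head (e i) = tail (e (i + 1))" for i
  proof (cases "i mod L + 1 < L")
    case True
    have "nat (i mod L + 1) = Suc (nat (i mod L))" using pos_mod_sign[OF L, of i] by simp
    then have e1: "e (i + 1) = W ! Suc (nat (i mod L))" unfolding e_def using succ_div_mod(1)[OF L True] by simp
    have "Suc (nat (i mod L)) < length W" using True pos_mod_sign[OF L, of i] unfolding L_def by linarith
    then show ?thesis using path e1 unfolding e_def by simp
  next
    case False
    then have m: "(i + 1) mod L = 0" "i mod L = L - 1" using succ_div_mod(2)[OF L False] by auto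
    have "nat (L - 1) = length W - 1" by (simp add: L_def)
    then show ?thesis
      using closed \<open>W \<noteq> []\<close> m by (simp add: e_def last_conv_nth hd_conv_nth)
  qed
  have wv: "walk_vertices W = range (\<lambda>i. tail (e i))"
  proof -
    have "tail ` set W = range (\<lambda>i. tail (e i))" "head ` set W = range (\<lambda>i. tail (e (i + 1)))"
      unfolding range_e[symmetric] image_image ht by auto
    then show ?thesis unfolding walk_vertices_def by auto
  qed
  have tail_in: "tail a \<in> arcs M" if "a \<in> synthetic_edges M" for a
  proof -
    have "arc_list M ! i \<in> arcs M" if "i < length (arc_list M)" for i
      using that arc_list_props(1) nth_mem by blast
    then show ?thesis using that unfolding synthetic_edges_def by auto
  qed
  have "\<forall>A\<in>arcs M. \<exists>y. arc y = A \<and> 0 \<le> y \<and> y < n" using arc_surj by metis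
  then obtain idx where idx: "\<And>A. A \<in> arcs M \<Longrightarrow> arc (idx A) = A \<and> 0 \<le> idx A \<and> idx A < n"
    by metis
  define S where "S = periodic_sum (ext_weight M) W"
  define x where "x i = idx (tail (e i)) + n * (- S i)" for i
  have S_succ: "S (i + 1) = S i + ext_weight M (e i)" for i
    using periodic_sum_succ[OF \<open>W \<noteq> []\<close>] unfolding S_def e_def L_def by blast
  have idx_e: "arc (idx (tail (e i))) = tail (e i)" "0 \<le> idx (tail (e i))" "idx (tail (e i)) < n" for i
    using idx tail_in eW edges by blast+
  have x_arc: "arc (x i) = tail (e i)" for i
    unfolding x_def arc_shift by (rule idx_e)
  have x_div: "x i div n = - S i" for i
    using idx_e[of i] n_pos unfolding x_def by (simp del: mult_minus_right)
  have move: "edge_move (x i) (balance (kind (e i))) (x (i + 1))" for i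
  proof -
    obtain y where y: "head (e i) = arc y" "y div n = x i div n - ext_weight M (e i)"
      "edge_move (x i) (balance (kind (e i))) y"
      using lift_edge[of "e i" "x i"] eW edges x_arc by (metis subsetD)
    \<comment> \<open>The lifted head and the next lifted tail have the same residue and the same
      turn.\<close>
    have "arc y = arc (x (i + 1))" using y(1) ht x_arc by simp
    then have "y mod n = x (i + 1) mod n" by (simp add: arc_eq_iff)
    moreover have "y div n = x (i + 1) div n" using y(2) x_div S_succ by simp
    ultimately have "y = x (i + 1)" by (metis mult_div_mod_eq)
    then show ?thesis using y(3) by simp
  qed
  have x_shift: "x (i + L) = x i - n * Ext M W" for i
    using periodic_sum_shift[OF \<open>W \<noteq> []\<close>, of "ext_weight M" i]
    by (simp add: x_def S_def e_def Ext_eq_sum_list L_def algebra_simps)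
  show ?thesis
  proof (rule that[OF L range_e wv x_arc move x_shift])
    show "periodic_sum (\<lambda>e. balance (kind e)) W (i + 1) =
        periodic_sum (\<lambda>e. balance (kind e)) W i + balance (kind (e i))" for i
      using periodic_sum_succ[OF \<open>W \<noteq> []\<close>] unfolding e_def L_def by blast
    show "periodic_sum (\<lambda>e. balance (kind e)) W (i + L) =
        periodic_sum (\<lambda>e. balance (kind e)) W i + (\<Sum>e\<leftarrow>W. balance (kind e))" for i
      using periodic_sum_shift[OF \<open>W \<noteq> []\<close>] unfolding L_def by blast
  qed
qed

text \<open>A common vertex of the lifted paths projects to a common arc, so it remains to exclude
  equal slopes.\<close>

lemma circuits_meet:
  assumes real: "unit_realization \<psi> l C" and W: "circuit M W" and W': "circuit M W'"
    and sgn: "sgn (Ext M W) \<noteq> sgn (Ext M W')"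
  shows "walk_vertices W \<inter> walk_vertices W' \<noteq> {}"
proof -
  define pos where "pos = (\<lambda>(x, u). \<psi> x - real_of_int u * l)"
  define E where "E = (\<lambda>(x, u) (y, v). edge_move x (v - u) y)"
  interpret level_graph pos snd E
    unfolding pos_def E_def using level_graph_of_realization[OF real] .
  have \<psi>_shift: "\<psi> (x - n * t) = \<psi> x - C * real_of_int t" for x t
    using shift_multiple[of \<psi> n C x "- t"] real by (simp add: unit_realization_def)
  have C: "0 < C"
  proof -
    have "\<psi> 0 < \<psi> (0 + n)" using real n_pos by (simp add: unit_realization_def strict_mono_less)
    then show ?thesis using real by (simp add: unit_realization_def del: add_0)
  qed
  have lift: "\<exists>(v :: int \<Rightarrow> int \<times> int) (L :: int) b. (\<forall>i. E (v i) (v (i + 1))) \<and> 0 < L \<and>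
      (\<forall>i. pos (v (i + L)) = pos (v i) + (- C * real_of_int (Ext M W) - real_of_int b * l)) \<and>
      (\<forall>i. snd (v (i + L)) = snd (v i) + b) \<and> range (\<lambda>i. arc (fst (v i))) = walk_vertices W"
    if W: "circuit M W" for W
  proof (rule lift_circuit[OF W])
    fix L :: int and e :: "int \<Rightarrow> edge" and x u :: "int \<Rightarrow> int" and b :: int
    assume *: "0 < L" "range e = set W" "walk_vertices W = range (\<lambda>i. tail (e i))"
      "\<And>i. arc (x i) = tail (e i)" "\<And>i. edge_move (x i) (balance (kind (e i))) (x (i + 1))"
      "\<And>i. x (i + L) = x i - n * Ext M W"
      "\<And>i. u (i + 1) = u i + balance (kind (e i))" "\<And>i. u (i + L) = u i + b"
    have "\<psi> (x (i + L)) = \<psi> (x i) - C * real_of_int (Ext M W)" for i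
      unfolding *(6) by (rule \<psi>_shift)
    then show ?thesis
      by (intro exI[of _ "\<lambda>i. (x i, u i)"] exI[of _ L] exI[of _ b])
        (simp add: E_def pos_def *(1,3,4,5,7,8) distrib_right)
  qed
  obtain v :: "int \<Rightarrow> int \<times> int" and L b where v: "\<And>i. E (v i) (v (i + 1))" "0 < L"
      "\<And>i. pos (v (i + L)) = pos (v i) + (- C * real_of_int (Ext M W) - real_of_int b * l)"
      "\<And>i. snd (v (i + L)) = snd (v i) + b" and wv: "range (\<lambda>i. arc (fst (v i))) = walk_vertices W"
    using lift[OF W] by blast
  obtain w :: "int \<Rightarrow> int \<times> int" and L' b' where w: "\<And>i. E (w i) (w (i + 1))" "0 < L'"
      "\<And>i. pos (w (i + L')) = pos (w i) + (- C * real_of_int (Ext M W') - real_of_int b' * l)"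
      "\<And>i. snd (w (i + L')) = snd (w i) + b'" and ww: "range (\<lambda>i. arc (fst (w i))) = walk_vertices W'"
    using lift[OF W'] by blast
  define t t' where "t = real_of_int (Ext M W)" and "t' = real_of_int (Ext M W')"
  define P where "P = - C * t - real_of_int b * l"
  define P' where "P' = - C * t' - real_of_int b' * l"
  have P: "0 < P" using periodic_path_slope[of v, OF v] unfolding P_def t_def by blast
  have P': "0 < P'" using periodic_path_slope[of w, OF w] unfolding P'_def t'_def by blast
  \<comment> \<open>If the slopes agreed, \<open>b\<close> and \<open>b'\<close> could be eliminated
    from the formulas for \<open>P\<close> and \<open>P'\<close>, leaving
    \<open>t * P' = t' * P\<close>. As \<open>P\<close> and \<open>P'\<close> are positive,
    \<open>t\<close> and \<open>t'\<close> would have the same sign.\<close>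
  have "real_of_int b' * P \<noteq> real_of_int b * P'"
  proof
    assume eq: "real_of_int b' * P = real_of_int b * P'"
    have "C * (real_of_int b' * t - real_of_int b * t') = real_of_int b * P' - real_of_int b' * P"
      by (simp add: P_def P'_def algebra_simps)
    then have "real_of_int b' * t = real_of_int b * t'" using eq C by simp
    moreover have "t * P' - t' * P = l * (real_of_int b * t' - real_of_int b' * t)"
      by (simp add: P_def P'_def algebra_simps)
    ultimately have "t * P' = t' * P" by simp
    then have "sgn t * sgn P' = sgn t' * sgn P" by (metis sgn_mult)
    then have "sgn t = sgn t'" using P P' by simp
    then show False using sgn by (simp add: t_def t'_def sgn_if split: if_splits)
  qed
  then obtain i j where "v i = w j"
    using nonparallel_paths_meet[of v L P b w L' P' b'] v w unfolding P_def P'_def t_def t'_def by blast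
  then have "arc (fst (v i)) \<in> walk_vertices W'" unfolding ww[symmetric] by simp
  moreover have "arc (fst (v i)) \<in> walk_vertices W" unfolding wv[symmetric] by (rule rangeI)
  ultimately show ?thesis by blast
qed

section \<open>Unit models and unit realizations\<close>

text \<open>An equivalence preserves the order of all extremes, hence which arcs wrap, and so, turns
  being compared first, the order of all lifted extremes. With a common length the lifted ends are
  the lifted starts shifted by \<open>l\<close>.\<close>

lemma realization_of_UCA:
  assumes "UCA_model M'" "equivalent_models M M'"
  shows "\<exists>\<psi> l C. unit_realization \<psi> l C"
proof -
  obtain f where bij: "bij_betw f (arcs M) (arcs M')"
    and order: "\<And>A B e e'. A \<in> arcs M \<Longrightarrow> B \<in> arcs M \<Longrightarrow> e \<in> {start, stop} \<Longrightarrow> e' \<in> {start, stop} \<Longrightarrow>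
      e (f A) < e' (f B) \<longleftrightarrow> e A < e' B"
    using assms(2) unfolding equivalent_models_def by blast
  have fin': "f A \<in> arcs M'" if "A \<in> arcs M" for A using bij that bij_betwE by blast
  interpret M': pca M'
    using assms(1) bij nonempty by unfold_locales (auto simp: UCA_model_def bij_betw_def)
  define C where "C = circ M'"
  define l where "l = arc_length M' (f (arc 0))"
  have len: "arc_length M' (f (arc x)) = l" for x
    using assms(1) fin' unfolding l_def UCA_model_def by simp
  have wrap: "wrap (f (arc x)) = wrap (arc x)" for x
    using order[of "arc x" "arc x" start stop] by (simp add: wrap_def)
  define \<psi> where "\<psi> x = start (f (arc x)) + C * real_of_int (x div n)" for x
  have end_eq: "\<psi> x + l = stop (f (arc x)) + C * real_of_int (x div n + wrap (arc x))" for x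
    using arc_end_length[of M' "f (arc x)"] len[of x] wrap[of x]
    by (simp add: \<psi>_def arc_end_def C_def algebra_simps)
  have ranges: "0 \<le> start (f (arc x))" "start (f (arc x)) < C" "0 \<le> stop (f (arc x))" "stop (f (arc x)) < C"
    for x using M'.start_range M'.stop_range fin' by (auto simp: C_def)
  have ss: "\<psi> x < \<psi> y \<longleftrightarrow> s x < s y" for x y
  proof -
    have "\<psi> x < \<psi> y \<longleftrightarrow> x div n < y div n \<or> x div n = y div n \<and> start (f (arc x)) < start (f (arc y))"
      unfolding \<psi>_def by (rule lift_less_iff) (use ranges in auto)
    also have "\<dots> \<longleftrightarrow> x div n < y div n \<or> x div n = y div n \<and> start (arc x) < start (arc y)"
      using order[of "arc x" "arc y" start start] by simp
    also have "\<dots> \<longleftrightarrow> s x < s y"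
      unfolding s_def by (rule lift_less_iff[symmetric]) (auto simp: start_range)
    finally show ?thesis .
  qed
  have ts: "\<psi> x + l < \<psi> y \<longleftrightarrow> T x < s y" for x y
  proof -
    have "\<psi> x + l < \<psi> y \<longleftrightarrow> x div n + wrap (arc x) < y div n \<or>
        x div n + wrap (arc x) = y div n \<and> stop (f (arc x)) < start (f (arc y))"
      unfolding end_eq unfolding \<psi>_def by (rule lift_less_iff) (use ranges in auto)
    also have "\<dots> \<longleftrightarrow> T x < s y"
      unfolding T_less_s_iff using order[of "arc x" "arc y" stop start] by simp
    finally show ?thesis .
  qed
  have st: "\<psi> y < \<psi> x + l \<longleftrightarrow> s y < T x" for x y
  proof -
    have "\<psi> y < \<psi> x + l \<longleftrightarrow> y div n < x div n + wrap (arc x) \<or>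
        y div n = x div n + wrap (arc x) \<and> start (f (arc y)) < stop (f (arc x))"
      unfolding end_eq unfolding \<psi>_def by (rule lift_less_iff) (use ranges in auto)
    also have "\<dots> \<longleftrightarrow> s y < T x"
      unfolding s_less_T_iff using order[of "arc y" "arc x" start stop] by simp
    finally show ?thesis .
  qed
  have "unit_realization \<psi> l C"
    unfolding unit_realization_def
  proof (intro conjI allI impI)
    show "strict_mono \<psi>" by (rule strict_monoI) (simp add: ss s_less)
    show "\<psi> (x + n) = \<psi> x + C" for x using n_pos by (simp add: \<psi>_def algebra_simps)
    show "\<psi> x + l < \<psi> y" if "nu x \<le> y" for x y using that by (simp add: ts nu_le_iff)
    show "\<psi> y < \<psi> x + l" if "y < nu x" for x y
      using that nu_le_iff[of x y] T_neq_s[of x y] st[of y x] by linarith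
  qed
  then show ?thesis by blast
qed

lemma UCA_of_realization:
  assumes real: "unit_realization \<psi> l C"
  shows "\<exists>M'. UCA_model M' \<and> equivalent_models M M'"
proof -
  have \<psi>_mono: "strict_mono \<psi>" and \<psi>_shift: "\<And>x. \<psi> (x + n) = \<psi> x + C"
    and nose: "\<And>x y. nu x \<le> y \<Longrightarrow> \<psi> x + l < \<psi> y" and no_nose: "\<And>x y. y < nu x \<Longrightarrow> \<psi> y < \<psi> x + l"
    using real by (auto simp: unit_realization_def)
  have C: "0 < C" using strict_mono_less[OF \<psi>_mono, of 0 "0 + n"] \<psi>_shift[of 0] n_pos by simp
  \<comment> \<open>The order isomorphism from the lifted extremes of \<open>M\<close> to those of
    the model under construction; it turns a full turn \<open>c\<close> into
    \<open>C\<close>.\<close>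
  define \<Phi> where "\<Phi> w = (if w \<in> range s then \<psi> (inv s w) else \<psi> (inv T w) + l)" for w
  have \<Phi>_s: "\<Phi> (s x) = \<psi> x" for x
    using strict_mono_imp_inj_on[OF s_mono] by (simp add: \<Phi>_def)
  have \<Phi>_T: "\<Phi> (T x) = \<psi> x + l" for x
    using strict_mono_imp_inj_on[OF T_mono] T_neq_s by (auto simp: \<Phi>_def)
  define X where "X = range s \<union> range T"
  have \<Phi>_less: "\<Phi> w < \<Phi> w'" if "w \<in> X" "w' \<in> X" "w < w'" for w w'
  proof -
    consider x y where "w = s x" "w' = s y" | x y where "w = s x" "w' = T y"
      | x y where "w = T x" "w' = s y" | x y where "w = T x" "w' = T y"
      using \<open>w \<in> X\<close> \<open>w' \<in> X\<close> unfolding X_def by blast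
    then show ?thesis
    proof cases
      case 1
      then show ?thesis using \<open>w < w'\<close> by (simp add: \<Phi>_s s_less strict_mono_less[OF \<psi>_mono])
    next
      case 2
      then have "x < nu y" using \<open>w < w'\<close> nu_le_iff[of y x] by auto
      then show ?thesis using 2 no_nose by (simp add: \<Phi>_s \<Phi>_T)
    next
      case 3
      then have "nu x \<le> y" using \<open>w < w'\<close> nu_le_iff[of x y] by auto
      then show ?thesis using 3 nose by (simp add: \<Phi>_s \<Phi>_T)
    next
      case 4
      then show ?thesis using \<open>w < w'\<close> by (simp add: \<Phi>_T T_less strict_mono_less[OF \<psi>_mono])
    qed
  qed
  have \<Phi>_less_iff: "\<Phi> w < \<Phi> w' \<longleftrightarrow> w < w'" if "w \<in> X" "w' \<in> X" for w w'
    using \<Phi>_less[of w w'] \<Phi>_less[of w' w] that by (cases w w' rule: linorder_cases) auto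
  have \<Phi>_eq_iff: "\<Phi> w = \<Phi> w' \<longleftrightarrow> w = w'" if "w \<in> X" "w' \<in> X" for w w'
    using \<Phi>_less_iff[of w w'] \<Phi>_less_iff[of w' w] that by (cases w w' rule: linorder_cases) auto
  have \<Phi>_shift: "w + c \<in> X \<and> \<Phi> (w + c) = \<Phi> w + C" if "w \<in> X" for w
  proof -
    consider x where "w = s x" | x where "w = T x" using \<open>w \<in> X\<close> unfolding X_def by blast
    then show ?thesis
    proof cases
      case 1
      have "w + c = s (x + n)" by (simp add: 1 s_shift)
      then show ?thesis by (simp add: X_def 1 \<Phi>_s \<psi>_shift)
    next
      case 2
      have "w + c = T (x + n)" by (simp add: 2 T_shift)
      then show ?thesis by (simp add: X_def 2 \<Phi>_T \<psi>_shift)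
    qed
  qed
  have ext_X: "w \<in> X" if "w \<in> extremes M" for w
  proof -
    have "w = w + c * real_of_int 0" by simp
    then show ?thesis using lifted_extremes[of w] that unfolding X_def by blast
  qed
  have ext_fin: "finite (extremes M)" and ext_ne: "extremes M \<noteq> {}"
    using fin nonempty by (auto simp: extremes_def)
  have ext_range: "0 \<le> w" "w < c" if "w \<in> extremes M" for w
    using that pca by (auto simp: PCA_model_def)
  have in_ext: "start A \<in> extremes M" "stop A \<in> extremes M" if "A \<in> arcs M" for A
    using that by (auto simp: extremes_def)
  define m where "m = Min (extremes M)"
  have m: "m \<in> extremes M" unfolding m_def using ext_fin ext_ne by (rule Min_in)
  \<comment> \<open>Placing the distinguished point at the image of the smallest extreme brings all
    images into the range from 0 to \<open>C\<close> without changing their order.\<close>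
  define \<theta> where "\<theta> w = \<Phi> w - \<Phi> m" for w
  have \<theta>_less: "\<theta> w < \<theta> w' \<longleftrightarrow> w < w'" and \<theta>_eq: "\<theta> w = \<theta> w' \<longleftrightarrow> w = w'"
    if "w \<in> extremes M" "w' \<in> extremes M" for w w'
    using \<Phi>_less_iff \<Phi>_eq_iff ext_X that by (auto simp: \<theta>_def)
  have \<theta>_range: "0 \<le> \<theta> w" "\<theta> w < C" if w: "w \<in> extremes M" for w
  proof -
    have "m \<le> w" unfolding m_def using ext_fin w by (rule Min_le)
    then show "0 \<le> \<theta> w" using \<theta>_less[of w m] w m by (simp add: \<theta>_def not_less[symmetric])
    have "w < m + c" using ext_range[OF w] ext_range[OF m] by linarith
    then have "\<Phi> w < \<Phi> m + C" using \<Phi>_less_iff[of w "m + c"] \<Phi>_shift[of m] ext_X w m by simp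
    then show "\<theta> w < C" by (simp add: \<theta>_def)
  qed
  define f where "f A = (\<theta> (start A), \<theta> (stop A))" for A
  have f: "start (f A) = \<theta> (start A)" "stop (f A) = \<theta> (stop A)" for A by (simp_all add: f_def)
  define M' where "M' = \<lparr>circ = C, arcs = f ` arcs M\<rparr>"
  have M': "circ M' = C" "arcs M' = f ` arcs M" by (simp_all add: M'_def)
  have range: "0 \<le> start (f A)" "start (f A) < circ M'" "0 \<le> stop (f A)" "stop (f A) < circ M'"
    "start (f A) \<noteq> stop (f A)" if "A \<in> arcs M" for A
    using \<theta>_range \<theta>_eq in_ext stop_neq_start[of A A] that by (auto simp: M' f)
  have start_f: "A = B" if "A \<in> arcs M" "B \<in> arcs M" "start (f A) = start (f B)" for A B
    using that \<theta>_eq in_ext inj_onD[OF start_inj] by (simp add: f)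
  have len: "arc_length M' (f A) = l" if A: "A \<in> arcs M" for A
  proof -
    obtain x where x: "arc x = A" "0 \<le> x" "x < n" using arc_surj[OF A] .
    have sx: "s x = start A" and Tx: "T x = stop A + c * real_of_int (wrap A)"
      using x by (simp_all add: s_def T_alt)
    have less: "start (f A) < stop (f A) \<longleftrightarrow> start A < stop A"
      using \<theta>_less in_ext[OF A] by (simp add: f)
    show ?thesis
    proof (cases "start A < stop A")
      case True
      then have "T x = stop A" using Tx by (simp add: wrap_def)
      then show ?thesis using True less \<Phi>_s[of x] \<Phi>_T[of x] sx
        by (simp add: arc_length_def f \<theta>_def)
    next
      case False
      then have "T x = stop A + c" using Tx by (simp add: wrap_def)
      then have "\<Phi> (stop A) + C = \<psi> x + l" using \<Phi>_T[of x] \<Phi>_shift ext_X in_ext[OF A] by simp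
      then show ?thesis using False less \<Phi>_s[of x] sx
        by (simp add: arc_length_def f \<theta>_def M')
    qed
  qed
  have points: "start (f A) \<in> arc_points M' (f B) \<longleftrightarrow> start A \<in> arc_points M B"
    if AB: "A \<in> arcs M" "B \<in> arcs M" for A B
    using range(1,2)[OF AB(1)] start_range[OF AB(1)] \<theta>_less in_ext[OF AB(1)] in_ext[OF AB(2)]
    by (simp add: arc_points_def cw_arc_def f)
  have "PCA_model M'"
    unfolding PCA_model_def
  proof (intro conjI ballI impI)
    show "0 < circ M'" using C by (simp add: M')
    show "finite (arcs M')" using fin by (simp add: M')
    show "extremes M' \<subseteq> {0..<circ M'}" using range by (auto simp: extremes_def M'(2))
    show "\<not> arc_points M' A' \<subseteq> arc_points M' B'" if "A' \<in> arcs M'" "B' \<in> arcs M'" "A' \<noteq> B'" for A' B'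
    proof
      assume sub: "arc_points M' A' \<subseteq> arc_points M' B'"
      obtain A B where AB: "A \<in> arcs M" "A' = f A" "B \<in> arcs M" "B' = f B"
        using \<open>A' \<in> arcs M'\<close> \<open>B' \<in> arcs M'\<close> by (auto simp: M')
      have "start (f A) = start (f B)"
        using contained_same_length[OF range[OF AB(1)] range[OF AB(3)]] sub len AB by simp
      then show False using start_f AB \<open>A' \<noteq> B'\<close> by blast
    qed
    show "arc_points M' A' \<union> arc_points M' B' \<noteq> {0..<circ M'}" if "A' \<in> arcs M'" "B' \<in> arcs M'" for A' B'
    proof
      assume cover: "arc_points M' A' \<union> arc_points M' B' = {0..<circ M'}"
      obtain A B where AB: "A \<in> arcs M" "A' = f A" "B \<in> arcs M" "B' = f B"
        using \<open>A' \<in> arcs M'\<close> \<open>B' \<in> arcs M'\<close> by (auto simp: M')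
      \<comment> \<open>As no arc contains its own start, a cover puts each start inside the other
        arc; this passes back to \<open>M\<close> and yields a cover there.\<close>
      have own: "start D \<notin> arc_points M D" if "D \<in> arcs M" for D
        using that stop_neq_start[of D D] by (auto simp: arc_points_def cw_arc_def)
      have "start (f A) \<in> {0..<circ M'}" "start (f B) \<in> {0..<circ M'}" using range AB by auto
      then have "start A \<in> arc_points M A \<union> arc_points M B" "start B \<in> arc_points M A \<union> arc_points M B"
        unfolding cover[symmetric] using points AB by auto
      then have "arc_points M A \<union> arc_points M B = {0..<c}"
        using own AB start_range stop_range by (intro mutual_starts_cover) auto
      then show False using pca AB unfolding PCA_model_def by blast
    qed
    show "stop A' \<noteq> start B'" if "A' \<in> arcs M'" "B' \<in> arcs M'" for A' B'
      using that \<theta>_eq in_ext stop_neq_start by (auto simp: M' f)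
  qed
  then have "UCA_model M'" using len by (auto simp: UCA_model_def M')
  moreover have "equivalent_models M M'"
    unfolding equivalent_models_def
  proof (intro exI[of _ f] conjI ballI)
    show "bij_betw f (arcs M) (arcs M')"
      using start_f by (auto simp: bij_betw_def inj_on_def M')
    show "e (f A) < e' (f B) \<longleftrightarrow> e A < e' B"
      if "A \<in> arcs M" "B \<in> arcs M" "e \<in> {start, stop}" "e' \<in> {start, stop}" for A B e e'
      using that(3,4) \<theta>_less in_ext[OF that(1)] in_ext[OF that(2)] by (auto simp: f)
  qed
  ultimately show ?thesis by blast
qed

section \<open>Greedy cycles as orbits of \<open>nu\<close> and \<open>eta\<close>\<close>

text \<open>A greedy step leaves \<open>nu\<close> unchanged, as no nose leaves its tail. So
  iterates of \<open>nu\<close> follow the noses of the cycle: exactly when started at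
  \<open>nu x\<close>, and as a lower bound when started at \<open>x\<close>, since steps only add
  to the advance. All edges go forward, which makes \<open>Ext\<close> negative.\<close>

lemma greedy_nose_lift:
  assumes W: "greedy_nose_cycle M W" and A: "A \<in> walk_vertices W"
  obtains x k where "arc x = A" "0 < k" "(nu ^^ k) x \<le> x - n * Ext M W"
    "(nu ^^ k) (nu x) = nu x - n * Ext M W" "Ext M W < 0"
proof -
  have circ: "circuit M W" and greedy: "\<And>e. e \<in> set W \<Longrightarrow> kind e \<noteq> Hollow \<and>
      (kind e = Nose \<or> (\<nexists>B. Edge (tail e) Nose B \<in> synthetic_edges M))"
    using W by (auto simp: greedy_nose_cycle_def cycle_def greedy_nose_walk_def nose_walk_def)
  obtain L :: int and e :: "int \<Rightarrow> edge" and x u :: "int \<Rightarrow> int" and b :: int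
    where L: "0 < L" and e: "range e = set W" and wv: "walk_vertices W = range (\<lambda>i. tail (e i))"
    and arc_x: "\<And>i. arc (x i) = tail (e i)"
    and move: "\<And>i. edge_move (x i) (balance (kind (e i))) (x (i + 1))"
    and shift: "\<And>i. x (i + L) = x i - n * Ext M W"
    using lift_circuit[OF circ] by metis
  have step: "x (i + 1) = nu (x i) \<or> x (i + 1) = x i + 1 \<and> nu (x i + 1) = nu (x i)" for i
  proof (cases "kind (e i)")
    case Step
    moreover have "e i \<in> set W" using e by blast
    ultimately have "\<nexists>B. Edge (tail (e i)) Nose B \<in> synthetic_edges M"
      using greedy[of "e i"] by simp
    then have "Edge (arc (x i)) Nose (arc (nu (x i))) \<notin> synthetic_edges M"
      unfolding arc_x by blast
    then have "nu (x i + 1) = nu (x i)" using nose_edge_iff by blast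
    then show ?thesis using move[of i] Step by (auto simp: edge_move_def balance_def)
  qed (use greedy[of "e i"] e move[of i] in \<open>auto simp: edge_move_def balance_def\<close>)
  have "strict_mono x"
  proof (rule int_strict_monoI)
    show "x i < x (i + 1)" for i using step[of i] nu_gt[of "x i"] by auto
  qed
  obtain i where i: "tail (e i) = A" using A wv by auto
  \<comment> \<open>\<open>k\<close> is the number of noses among the first \<open>a\<close> edges
    from \<open>x i\<close>.\<close>
  have iter: "\<exists>k. (nu ^^ k) (x i) \<le> x (i + int a) \<and> (nu ^^ k) (nu (x i)) = nu (x (i + int a))" for a
  proof (induction a)
    case 0
    show ?case by (intro exI[of _ 0]) simp
  next
    case (Suc a)
    then obtain k where k: "(nu ^^ k) (x i) \<le> x (i + int a)" "(nu ^^ k) (nu (x i)) = nu (x (i + int a))"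
      by blast
    have a: "i + int (Suc a) = i + int a + 1" by simp
    show ?case
    proof (cases "x (i + int a + 1) = nu (x (i + int a))")
      case True
      then show ?thesis unfolding a using k monoD[OF nu_mono k(1)]
        by (intro exI[of _ "Suc k"]) simp
    next
      case False
      then show ?thesis unfolding a using k step[of "i + int a"]
        by (intro exI[of _ k]) auto
    qed
  qed
  obtain k where k: "(nu ^^ k) (x i) \<le> x i - n * Ext M W" "(nu ^^ k) (nu (x i)) = nu (x i - n * Ext M W)"
    using iter[of "nat L"] L shift by auto
  have nu_x: "nu (x i - n * Ext M W) = nu (x i) - n * Ext M W"
    using shift_multiple[of nu n n "x i" "- Ext M W", OF nu_shift] by simp
  have "x i < x (i + L)" using \<open>strict_mono x\<close> L by (simp add: strict_mono_less)
  then have neg: "n * Ext M W < 0" using shift[of i] by simp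
  then have "Ext M W < 0" using n_pos by (simp add: mult_less_0_iff)
  moreover have "0 < k"
  proof (rule ccontr)
    assume "\<not> 0 < k"
    then have "nu (x i) = nu (x i - n * Ext M W)" using k(2) by simp
    then show False using nu_x neg by linarith
  qed
  ultimately show ?thesis using that[of "x i" k] k nu_x arc_x i by simp
qed

text \<open>Steps and hollows go in opposite directions, so the sign of \<open>Ext\<close> is read
  off at \<open>eta x\<close>: it returns to itself up to full turns, and iterates of
  \<open>eta\<close> never move forward.\<close>

lemma greedy_hollow_lift:
  assumes W: "greedy_hollow_cycle M W" and A: "A \<in> walk_vertices W"
  obtains x k where "arc x = A" "0 < k" "(eta ^^ k) x \<le> x - n * Ext M W"
    "(eta ^^ k) (eta x) = eta x - n * Ext M W" "0 \<le> Ext M W"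
proof -
  have circ: "circuit M W" and greedy: "\<And>e. e \<in> set W \<Longrightarrow> kind e \<noteq> Nose \<and>
      (kind e = Hollow \<or> (\<nexists>B. Edge (tail e) Hollow B \<in> synthetic_edges M))"
    using W by (auto simp: greedy_hollow_cycle_def cycle_def greedy_hollow_walk_def hollow_walk_def)
  obtain L :: int and e :: "int \<Rightarrow> edge" and x u :: "int \<Rightarrow> int" and b :: int
    where L: "0 < L" and e: "range e = set W" and wv: "walk_vertices W = range (\<lambda>i. tail (e i))"
    and arc_x: "\<And>i. arc (x i) = tail (e i)"
    and move: "\<And>i. edge_move (x i) (balance (kind (e i))) (x (i + 1))"
    and shift: "\<And>i. x (i + L) = x i - n * Ext M W"
    using lift_circuit[OF circ] by metis
  have step: "x (i + 1) = eta (x i) \<or> x (i + 1) = x i + 1 \<and> eta (x i + 1) = eta (x i)" for i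
  proof (cases "kind (e i)")
    case Step
    moreover have "e i \<in> set W" using e by blast
    ultimately have "\<nexists>B. Edge (tail (e i)) Hollow B \<in> synthetic_edges M"
      using greedy[of "e i"] by simp
    then have "Edge (arc (x i)) Hollow (arc (eta (x i))) \<notin> synthetic_edges M"
      unfolding arc_x by blast
    then have "eta (x i + 1) = eta (x i)" using hollow_edge_iff by blast
    then show ?thesis using move[of i] Step by (auto simp: edge_move_def balance_def)
  qed (use greedy[of "e i"] e move[of i] in \<open>auto simp: edge_move_def balance_def\<close>)
  obtain i where i: "tail (e i) = A" using A wv by auto
  \<comment> \<open>The last conjunct excludes a cycle without hollows: it would advance by
    \<open>L\<close>, against \<open>0 \<le> Ext M W\<close>.\<close>
  have iter: "\<exists>k. (eta ^^ k) (x i) \<le> x (i + int a) \<and> (eta ^^ k) (eta (x i)) = eta (x (i + int a)) \<and>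
      (k = 0 \<longrightarrow> x (i + int a) = x i + int a)" for a
  proof (induction a)
    case 0
    show ?case by (intro exI[of _ 0]) simp
  next
    case (Suc a)
    then obtain k where k: "(eta ^^ k) (x i) \<le> x (i + int a)" "(eta ^^ k) (eta (x i)) = eta (x (i + int a))"
      "k = 0 \<longrightarrow> x (i + int a) = x i + int a"
      by blast
    have a: "i + int (Suc a) = i + int a + 1" by simp
    show ?case
    proof (cases "x (i + int a + 1) = eta (x (i + int a))")
      case True
      then show ?thesis unfolding a using k monoD[OF eta_mono k(1)]
        by (intro exI[of _ "Suc k"]) simp
    next
      case False
      then show ?thesis unfolding a using k step[of "i + int a"]
        by (intro exI[of _ k]) auto
    qed
  qed
  obtain k where k: "(eta ^^ k) (x i) \<le> x i - n * Ext M W" "(eta ^^ k) (eta (x i)) = eta (x i - n * Ext M W)"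
    "k = 0 \<longrightarrow> x i - n * Ext M W = x i + L"
    using iter[of "nat L"] L shift by auto
  have eta_x: "eta (x i - n * Ext M W) = eta (x i) - n * Ext M W"
    using shift_multiple[of eta n n "x i" "- Ext M W", OF eta_shift] by simp
  have "(eta ^^ k) y \<le> y" for y
  proof (induction k)
    case (Suc k)
    then show ?case using eta_le[of "(eta ^^ k) y"] by simp
  qed simp
  then have "0 \<le> n * Ext M W" using k(2) eta_x by (metis diff_ge_0_iff_ge diff_diff_eq2 add_diff_cancel_left')
  then have "0 \<le> Ext M W" using n_pos by (simp add: zero_le_mult_iff)
  moreover have "0 < k"
  proof (rule ccontr)
    assume "\<not> 0 < k"
    then show False using k(3) L \<open>0 \<le> n * Ext M W\<close> by simp
  qed
  ultimately show ?thesis using that[of "x i" k] k eta_x arc_x i by simp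
qed

lemma realization_of_greedy:
  assumes "greedy_hollow_cycle M W" "greedy_nose_cycle M W'"
    and A: "A \<in> walk_vertices W" "A \<in> walk_vertices W'"
  shows "\<exists>\<psi> l C. unit_realization \<psi> l C"
proof -
  define p where "p = Ext M W"
  define m where "m = - Ext M W'"
  obtain x j where x: "arc x = A" "0 < j" "(eta ^^ j) x \<le> x - n * p" "(eta ^^ j) (eta x) = eta x - n * p"
    using greedy_hollow_lift[OF assms(1) A(1)] unfolding p_def by metis
  obtain y k where y: "arc y = A" "0 < k" "(nu ^^ k) y \<le> y + n * m" "(nu ^^ k) (nu y) = nu y + n * m"
    using greedy_nose_lift[OF assms(2) A(2)] unfolding m_def by (metis diff_conv_add_uminus mult_minus_right)
  \<comment> \<open>The two lifts of the common arc differ by full turns, so the bound for noses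
    holds at \<open>x\<close> as well.\<close>
  have "y mod n = x mod n" using x(1) y(1) by (simp add: arc_eq_iff flip: arc_eq_iff)
  then obtain t where t: "x = y + n * t" by (metis mod_eqE mult.commute)
  have nu_x: "(nu ^^ k) x \<le> x + n * m"
    using y(3) funpow_shift[of nu n k y t, OF nu_shift] unfolding t by simp
  have nu_iter: "((nu ^^ k) ^^ a) x \<le> x + n * (m * int a)" for a
  proof (induction a)
    case (Suc a)
    have "(nu ^^ k) (((nu ^^ k) ^^ a) x) \<le> (nu ^^ k) (x + n * (m * int a))"
      using Suc by (rule funpow_mono[OF nu_mono])
    then show ?case using nu_x funpow_shift[of nu n k x "m * int a", OF nu_shift]
      by (simp add: algebra_simps)
  qed simp
  have eta_iter: "((eta ^^ j) ^^ a) x \<le> x + n * (- p * int a)" for a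
  proof (induction a)
    case (Suc a)
    have "(eta ^^ j) (((eta ^^ j) ^^ a) x) \<le> (eta ^^ j) (x + n * (- p * int a))"
      using Suc by (rule funpow_mono[OF eta_mono])
    then show ?case using x(3) funpow_shift[of eta n j x "- p * int a", OF eta_shift]
      by (simp add: algebra_simps)
  qed simp
  \<comment> \<open>\<open>j * k\<close> iterations are \<open>j\<close> rounds of
    \<open>nu ^^ k\<close> and \<open>k\<close> rounds of \<open>eta ^^ j\<close>, which equalises
    noses and hollows.\<close>
  have "x < (eta ^^ (j * k)) ((nu ^^ (j * k)) x)"
    using x(2) y(2) by (intro eta_pow_nu_pow) simp
  also have "\<dots> \<le> (eta ^^ (j * k)) (x + n * (m * int j))"
    using nu_iter[of j] by (intro funpow_mono[OF eta_mono]) (simp add: funpow_mult mult.commute)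
  also have "\<dots> = (eta ^^ (j * k)) x + n * (m * int j)"
    by (rule funpow_shift) (rule eta_shift)
  also have "\<dots> \<le> x + n * (- p * int k) + n * (m * int j)"
    using eta_iter[of k] by (simp add: funpow_mult mult.commute)
  finally have "0 < n * (m * int j - p * int k)" by (simp add: algebra_simps)
  then have "p * int k < m * int j" using n_pos by (simp add: zero_less_mult_iff)
  \<comment> \<open>The exact periodic points are \<open>nu y\<close> and \<open>eta x\<close>; the
    inequalities at \<open>x\<close> served to compare the rates.\<close>
  then show ?thesis using unit_realization_exists[OF y(4,2) x(4,2)] by blast
qed

section \<open>Existence of greedy cycles\<close>

text \<open>One chosen outgoing edge per vertex defines a map on the finite set of arcs, and a
  periodic orbit of it is a cycle.\<close>

lemma functional_cycle:
  assumes step: "\<And>A. A \<in> arcs M \<Longrightarrow> g A \<in> synthetic_edges M \<and> tail (g A) = A"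
  obtains W where "cycle M W" "\<And>e. e \<in> set W \<Longrightarrow> \<exists>A\<in>arcs M. e = g A"
proof -
  define f where "f A = head (g A)" for A
  have f: "f A \<in> arcs M" if A: "A \<in> arcs M" for A
  proof -
    obtain x where "arc x = A" using arc_surj[OF A] by blast
    then show ?thesis using lift_edge[of "g A" x] step[OF A] unfolding f_def by (metis arc_in)
  qed
  obtain v where "v \<in> arcs M" using nonempty by blast
  then obtain u L where u: "u \<in> arcs M" and L: "0 < L" "(f ^^ L) u = u"
    and inj: "inj_on (\<lambda>i. (f ^^ i) u) {..<L}"
    using iterate_cycle[OF fin, of v f] f by metis
  have iter: "(f ^^ i) u \<in> arcs M" for i using u f by (induction i) auto
  define W where "W = map (\<lambda>i. g ((f ^^ i) u)) [0..<L]"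
  have len: "length W = L" and nth: "\<And>i. i < L \<Longrightarrow> W ! i = g ((f ^^ i) u)" by (simp_all add: W_def)
  have ne: "W \<noteq> []" using len L by auto
  have "walk M W"
    unfolding walk_def
  proof (intro conjI allI impI)
    show "set W \<subseteq> synthetic_edges M" using step[OF iter] by (auto simp: W_def)
    fix i assume "Suc i < length W"
    then show "head (W ! i) = tail (W ! Suc i)"
      using step[OF iter[of "Suc i"]] by (simp add: len nth f_def)
  qed (rule ne)
  moreover have "head (last W) = tail (hd W)"
  proof -
    have "head (last W) = f ((f ^^ (L - 1)) u)"
      using L ne by (simp add: last_conv_nth len nth f_def)
    also have "\<dots> = (f ^^ Suc (L - 1)) u" by simp
    also have "\<dots> = u" using L by simp
    also have "\<dots> = tail (hd W)" using L ne step[OF u] by (simp add: hd_conv_nth nth)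
    finally show ?thesis .
  qed
  moreover have "map tail W = map (\<lambda>i. (f ^^ i) u) [0..<L]" using step iter by (simp add: W_def)
  then have "distinct (map tail W)"
    using inj by (simp add: distinct_map atLeast0LessThan del: map_map)
  ultimately have "cycle M W" by (simp add: cycle_def circuit_def)
  moreover have "\<exists>A\<in>arcs M. a = g A" if "a \<in> set W" for a
  proof -
    have "a \<in> range (\<lambda>i. g ((f ^^ i) u))" using that by (auto simp: W_def)
    then show ?thesis using iter by blast
  qed
  ultimately show ?thesis using that by blast
qed

lemma step_leaves:
  assumes "A \<in> arcs M"
  shows "\<exists>e\<in>synthetic_edges M. tail e = A \<and> kind e = Step"
proof -
  obtain x where "arc x = A" using arc_surj[OF assms] by blast
  then have "Edge A Step (arc (x + 1)) \<in> synthetic_edges M" using step_edge_iff by blast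
  then show ?thesis by force
qed

text \<open>A step leaves every arc, so the greedy choice of an edge never gets stuck.\<close>

lemma greedy_nose_cycle_exists: "\<exists>W. greedy_nose_cycle M W"
proof -
  have "\<exists>e. e \<in> synthetic_edges M \<and> tail e = A \<and> kind e \<noteq> Hollow \<and>
      (kind e = Nose \<or> (\<nexists>B. Edge A Nose B \<in> synthetic_edges M))" if "A \<in> arcs M" for A
    using step_leaves[OF that] by (metis edge.sel edge_kind.distinct(3,5))
  then obtain g where g: "\<And>A. A \<in> arcs M \<Longrightarrow> g A \<in> synthetic_edges M \<and> tail (g A) = A \<and>
      kind (g A) \<noteq> Hollow \<and> (kind (g A) = Nose \<or> (\<nexists>B. Edge A Nose B \<in> synthetic_edges M))"
    by metis
  then obtain W where W: "cycle M W" "\<And>e. e \<in> set W \<Longrightarrow> \<exists>A\<in>arcs M. e = g A"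
    using functional_cycle[of g] by metis
  have "greedy_nose_cycle M W"
    using W(1) W(2) g unfolding greedy_nose_cycle_def greedy_nose_walk_def nose_walk_def cycle_def circuit_def
    by metis
  then show ?thesis by blast
qed

lemma greedy_hollow_cycle_exists: "\<exists>W. greedy_hollow_cycle M W"
proof -
  have "\<exists>e. e \<in> synthetic_edges M \<and> tail e = A \<and> kind e \<noteq> Nose \<and>
      (kind e = Hollow \<or> (\<nexists>B. Edge A Hollow B \<in> synthetic_edges M))" if "A \<in> arcs M" for A
    using step_leaves[OF that] by (metis edge.sel edge_kind.distinct(1,5))
  then obtain g where g: "\<And>A. A \<in> arcs M \<Longrightarrow> g A \<in> synthetic_edges M \<and> tail (g A) = A \<and>
      kind (g A) \<noteq> Nose \<and> (kind (g A) = Hollow \<or> (\<nexists>B. Edge A Hollow B \<in> synthetic_edges M))"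
    by metis
  then obtain W where W: "cycle M W" "\<And>e. e \<in> set W \<Longrightarrow> \<exists>A\<in>arcs M. e = g A"
    using functional_cycle[of g] by metis
  have "greedy_hollow_cycle M W"
    using W(1) W(2) g unfolding greedy_hollow_cycle_def greedy_hollow_walk_def hollow_walk_def cycle_def circuit_def
    by metis
  then show ?thesis by blast
qed

lemma greedy_cycles_meet:
  assumes "\<And>W W'. circuit M W \<Longrightarrow> circuit M W' \<Longrightarrow> sgn (Ext M W) \<noteq> sgn (Ext M W') \<Longrightarrow>
    walk_vertices W \<inter> walk_vertices W' \<noteq> {}"
  shows "\<exists>W W'. greedy_hollow_cycle M W \<and> greedy_nose_cycle M W' \<and>
    walk_vertices W \<inter> walk_vertices W' \<noteq> {}"
proof -
  obtain W W' where W: "greedy_hollow_cycle M W" and W': "greedy_nose_cycle M W'"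
    using greedy_hollow_cycle_exists greedy_nose_cycle_exists by blast
  have circ: "circuit M W" "circuit M W'"
    using W W' by (simp_all add: greedy_hollow_cycle_def greedy_nose_cycle_def cycle_def)
  have vertex: "\<exists>A. A \<in> walk_vertices W" if "circuit M W" for W
  proof -
    have "W \<noteq> []" using that by (simp add: circuit_def walk_def)
    then have "tail (hd W) \<in> walk_vertices W" by (simp add: walk_vertices_def)
    then show ?thesis by blast
  qed
  have "0 \<le> Ext M W" using vertex[OF circ(1)] greedy_hollow_lift[OF W] by metis
  moreover have "Ext M W' < 0" using vertex[OF circ(2)] greedy_nose_lift[OF W'] by metis
  ultimately have "sgn (Ext M W) \<noteq> sgn (Ext M W')" by (auto simp: sgn_if)
  then show ?thesis using assms circ W W' by blast
qed

end

theorem theorem7: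
  fixes M :: ca_model
  assumes "PCA_model M" and "arcs M \<noteq> {}"
  shows "((\<exists>M'. UCA_model M' \<and> equivalent_models M M') \<longleftrightarrow>
          (\<forall>W W'. circuit M W \<and> circuit M W' \<and> sgn (Ext M W) \<noteq> sgn (Ext M W') \<longrightarrow>
             walk_vertices W \<inter> walk_vertices W' \<noteq> {}))
       \<and> ((\<forall>W W'. circuit M W \<and> circuit M W' \<and> sgn (Ext M W) \<noteq> sgn (Ext M W') \<longrightarrow>
             walk_vertices W \<inter> walk_vertices W' \<noteq> {}) \<longleftrightarrow>
          (\<exists>W W'. greedy_hollow_cycle M W \<and> greedy_nose_cycle M W' \<and>
             walk_vertices W \<inter> walk_vertices W' \<noteq> {}))"
    (is "(?unit \<longleftrightarrow> ?circuits) \<and> (?circuits \<longleftrightarrow> ?greedy)")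
proof -
  interpret pca M using assms by unfold_locales
  \<comment> \<open>The existence of a unit realization is equivalent to the first statement and
    closes the chain of implications through the other two.\<close>
  have "?unit \<Longrightarrow> \<exists>\<psi> l C. unit_realization \<psi> l C" using realization_of_UCA by blast
  moreover have "\<exists>\<psi> l C. unit_realization \<psi> l C \<Longrightarrow> ?unit" using UCA_of_realization by blast
  moreover have "\<exists>\<psi> l C. unit_realization \<psi> l C \<Longrightarrow> ?circuits" using circuits_meet by blast
  moreover have "?circuits \<Longrightarrow> ?greedy" using greedy_cycles_meet by blast
  moreover have "?greedy \<Longrightarrow> \<exists>\<psi> l C. unit_realization \<psi> l C" using realization_of_greedy by blast
  ultimately show ?thesis by argo
qed

end
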